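(* Let $A$ be a finitely generated unital associative $\Bbbk$-algebra endowed with an involution $\phi$, and let $\{\!\!\{-,-\}\!\!\}$ be a double Poisson bracket on $A$ which is $\phi$-adapted. Let $d$ be a positive integer, let $\tau$ be an involution of $\operatorname{Mat}(d,\Bbbk)$, and write $\tau(E_{ij})=\sum_{m,n=1}^{d}\tau_{ij}^{mn}E_{mn}$, where $E_{ij}$ are the matrix units. Then the formula $$\{a_{ij},b_{kl}\}_{\phi,\tau}=\{\!\!\{a,b\}\!\!\}'_{kj}\,\{\!\!\{a,b\}\!\!\}''_{il}+\sum_{m,n=1}^{d}\tau_{mn}^{ij}\,\{\!\!\{\phi(a),b\}\!\!\}'_{kn}\,\{\!\!\{\phi(a),b\}\!\!\}''_{ml},\qquad a,b\in A,\quad i,j,k,l\in\{1,\dots,d\},$$ gives rise to a (well-defined) Poisson bracket $\{-,-\}_{\phi,\tau}$ on the commutative algebra $\mathcal O(A,d)^{\phi,\tau}$ (the twisted coordinate ring), whose values on the generators $a_{ij}$ are given by this formula.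
   Context: $\Bbbk$ is an algebraically closed field of characteristic $0$. Involution: an involution on an associative $\Bbbk$-algebra is a $\Bbbk$-linear antiautomorphism whose square is the identity. Tensor notation: elements $x\in A\otimes A$ are written in shorthand $x=x'\otimes x''$, meaning $x=\sum_i x_i'\otimes x_i''$; expressions containing both $x'$ and $x''$ are understood as the corresponding sums. For $x=x'\otimes x''$ put $x^\circ:=x''\otimes x'$. The symmetric group $\mathfrak S_3$ acts on $A^{\otimes 3}$ by $s\cdot(x_1\otimes x_2\otimes x_3)=x_{s^{-1}(1)}\otimes x_{s^{-1}(2)}\otimes x_{s^{-1}(3)}$; in particular $(123)\cdot(x'\otimes x''\otimes x''')=x'''\otimes x'\otimes x''$. Double bracket on $A$: a bilinear map $\{\!\!\{-,-\}\!\!\}:A\times A\to A\otimes A$ with $\{\!\!\{a,b\}\!\!\}=-\{\!\!\{b,a\}\!\!\}^\circ$ and $\{\!\!\{a,bc\}\!\!\}=\{\!\!\{a,b\}\!\!\}c+b\{\!\!\{a,c\}\!\!\}$, where $(x'\otimes x'')c:=x'\otimes(x''c)$ and $b(x'\otimes x''):=(bx')\otimes x''$. It is a double Poisson bracket if moreover for all $a,b,c\in A$ $$\{\!\!\{a,\{\!\!\{b,c\}\!\!\}\}\!\!\}_{\mathbf L}+(123)\cdot\{\!\!\{b,\{\!\!\{c,a\}\!\!\}\}\!\!\}_{\mathbf L}+(123)^2\cdot\{\!\!\{c,\{\!\!\{a,b\}\!\!\}\}\!\!\}_{\mathbf L}=0,$$ where $\{\!\!\{a,x'\otimes x''\}\!\!\}_{\mathbf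 L}:=\{\!\!\{a,x'\}\!\!\}\otimes x''\in A^{\otimes 3}$. The double bracket is $\phi$-adapted if $\phi^{\otimes 2}(\{\!\!\{a,b\}\!\!\})=\{\!\!\{\phi(a),\phi(b)\}\!\!\}^\circ$ for all $a,b\in A$. Coordinate ring: $\mathcal O(A,d)$ is the commutative unital $\Bbbk$-algebra generated by symbols $a_{ij}$ ($a\in A$, $1\le i,j\le d$), $\Bbbk$-linear in $a$, subject to $(ab)_{ij}=\sum_{r=1}^d a_{ir}b_{rj}$ and $1_{ij}=\delta_{ij}$. Twisted coordinate ring: $\mathcal O(A,d)^{\phi,\tau}$ is the quotient of $\mathcal O(A,d)$ by the ideal generated by the elements $\phi(a)_{ij}-\sum_{m,n=1}^d\tau_{mn}^{ij}\,a_{mn}$ for all $a\in A$, $1\le i,j\le d$. (Equivalently, writing $(a|x)$, $x\in\operatorname{Mat}^*(d,\Bbbk)$, for the linear extension of $(a|E_{ij}^* )=a_{ij}$, where $\{E^*_{ij}\}$ is the basis of the dual space dual to $\{E_{ij}\}$, one imposes $(\phi(a)|x)=(a|\tau^*(x))$ with $\tau^*$ the dual map of $\tau$.) The images of $a_{ij}$ in the quotient are denoted by the same symbols. A Poisson bracket on a commutative algebra is a Lie bracket that is a derivation in each argument. *)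

theory Defs
  imports
    "HOL-Library.Poly_Mapping"
    "HOL-Library.Set_Algebras"
    "HOL-Library.FuncSet"
    "HOL-Computational_Algebra.Polynomial"
    "HOL-Algebra.Algebraic_Closure_Type"
    "HOL-Analysis.Finite_Cartesian_Product"
begin

section \<open>Algebras and involutions\<close>

text \<open>The sort \<open>{ring, monoid_mult}\<close> is used instead of \<open>ring_1\<close> because the latter
  excludes the zero algebra.\<close>

locale k_algebra = vector_space scal
  for scal :: "'k::field \<Rightarrow> 'a::{ring, monoid_mult} \<Rightarrow> 'a" +
  assumes scale_mult_left: "scal c (x * y) = scal c x * y"
    and scale_mult_right: "scal c (x * y) = x * scal c y"

definition is_subalgebra :: "('k::field \<Rightarrow> 'a::{ring, monoid_mult} \<Rightarrow> 'a) \<Rightarrow> 'a set \<Rightarrow> bool" where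
  "is_subalgebra scal B \<longleftrightarrow>
     module.subspace scal B \<and> 1 \<in> B \<and> (\<forall>x\<in>B. \<forall>y\<in>B. x * y \<in> B)"

definition finitely_generated_algebra ::
    "('k::field \<Rightarrow> 'a::{ring, monoid_mult} \<Rightarrow> 'a) \<Rightarrow> bool" where
  "finitely_generated_algebra scal \<longleftrightarrow> (\<exists>S. finite S \<and> is_subalgebra scal hull S = UNIV)"

text \<open>The multiplication is a parameter because \<open>(*)\<close> on \<open>'k ^ 'n ^ 'n\<close> is the entrywise
  product; the product of matrices is \<open>(**)\<close>.\<close>

definition algebra_involution ::
    "('k::field \<Rightarrow> 'v::ab_group_add \<Rightarrow> 'v) \<Rightarrow> ('v \<Rightarrow> 'v \<Rightarrow> 'v) \<Rightarrow> ('v \<Rightarrow> 'v) \<Rightarrow> bool" where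
  "algebra_involution scal tms f \<longleftrightarrow>
     Vector_Spaces.linear scal scal f \<and>
     (\<forall>x y. f (tms x y) = tms (f y) (f x)) \<and>
     (\<forall>x. f (f x) = x)"

definition matrix_scale :: "'k::field \<Rightarrow> 'k ^ 'n ^ 'n \<Rightarrow> 'k ^ 'n ^ 'n" where
  "matrix_scale c M = (\<chi> i j. c * M $ i $ j)"

definition matrix_unit :: "'n \<Rightarrow> 'n \<Rightarrow> 'k::field ^ 'n ^ 'n" where
  "matrix_unit i j = (\<chi> p q. if p = i \<and> q = j then 1 else 0)"

text \<open>\<open>mcoeff \<tau> i j m n\<close> is the coefficient \<open>\<tau>\<^bsub>ij\<^esub>\<^bsup>mn\<^esup>\<close> of \<open>E\<^bsub>mn\<^esub>\<close> in \<open>\<tau>(E\<^bsub>ij\<^esub>)\<close>.\<close>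

definition mcoeff ::
    "('k::field ^ 'n ^ 'n \<Rightarrow> 'k ^ 'n ^ 'n) \<Rightarrow> 'n \<Rightarrow> 'n \<Rightarrow> 'n \<Rightarrow> 'n \<Rightarrow> 'k" where
  "mcoeff \<tau> i j m n = \<tau> (matrix_unit i j) $ m $ n"


section \<open>Tensor powers\<close>

text \<open>\<open>'b \<Rightarrow>\<^sub>0 'k\<close> is the vector space with basis \<open>'b\<close>. A quotient of it by a subspace \<open>N\<close> has the
  cosets \<open>x +o N\<close> as elements. The sum of two cosets is their elementwise sum \<open>S + T\<close>, the other
  operations go through a representative.\<close>

definition basis_vec :: "'b \<Rightarrow> 'b \<Rightarrow>\<^sub>0 'k::field" where
  "basis_vec b = Poly_Mapping.single b 1"

definition free_scale :: "'k::field \<Rightarrow> ('b \<Rightarrow>\<^sub>0 'k) \<Rightarrow> ('b \<Rightarrow>\<^sub>0 'k)" where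
  "free_scale c x = Poly_Mapping.map ((*) c) x"

definition linear_ext :: "('b \<Rightarrow> 'c \<Rightarrow>\<^sub>0 'k) \<Rightarrow> ('b \<Rightarrow>\<^sub>0 'k) \<Rightarrow> ('c \<Rightarrow>\<^sub>0 'k::field)" where
  "linear_ext f x = (\<Sum>b\<in>Poly_Mapping.keys x. free_scale (Poly_Mapping.lookup x b) (f b))"

definition quot_space :: "('b \<Rightarrow>\<^sub>0 'k::field) set \<Rightarrow> ('b \<Rightarrow>\<^sub>0 'k) set set" where
  "quot_space N = (\<lambda>x. x +o N) ` UNIV"

definition coset_rep :: "('b \<Rightarrow>\<^sub>0 'k::field) set \<Rightarrow> ('b \<Rightarrow>\<^sub>0 'k)" where
  "coset_rep T = (SOME x. x \<in> T)"

definition quot_scale ::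
    "('b \<Rightarrow>\<^sub>0 'k::field) set \<Rightarrow> 'k \<Rightarrow> ('b \<Rightarrow>\<^sub>0 'k) set \<Rightarrow> ('b \<Rightarrow>\<^sub>0 'k) set" where
  "quot_scale N c T = free_scale c (coset_rep T) +o N"

text \<open>\<open>quot_map N f\<close> is the linear map into the quotient by \<open>N\<close> induced by the values \<open>f\<close> on a basis.
  It is used only where the linear extension of \<open>f\<close> sends the subspace defining the source
  quotient into \<open>N\<close>, so that the choice of the representative does not matter.\<close>

definition quot_map ::
    "('c \<Rightarrow>\<^sub>0 'k::field) set \<Rightarrow> ('b \<Rightarrow> 'c \<Rightarrow>\<^sub>0 'k) \<Rightarrow> ('b \<Rightarrow>\<^sub>0 'k) set \<Rightarrow> ('c \<Rightarrow>\<^sub>0 'k) set" where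
  "quot_map N f T = linear_ext f (coset_rep T) +o N"

definition null2 :: "('k::field \<Rightarrow> 'a::ab_group_add \<Rightarrow> 'a) \<Rightarrow> ('a \<times> 'a \<Rightarrow>\<^sub>0 'k) set" where
  "null2 scal = module.span free_scale (
     {basis_vec (a + a', b) - basis_vec (a, b) - basis_vec (a', b) | a a' b. True} \<union>
     {basis_vec (a, b + b') - basis_vec (a, b) - basis_vec (a, b') | a b b'. True} \<union>
     {basis_vec (scal c a, b) - free_scale c (basis_vec (a, b)) | c a b. True} \<union>
     {basis_vec (a, scal c b) - free_scale c (basis_vec (a, b)) | c a b. True})"

definition null3 :: "('k::field \<Rightarrow> 'a::ab_group_add \<Rightarrow> 'a) \<Rightarrow> ('a \<times> 'a \<times> 'a \<Rightarrow>\<^sub>0 'k) set" where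
  "null3 scal = module.span free_scale (
     {basis_vec (x + x', y, z) - basis_vec (x, y, z) - basis_vec (x', y, z) | x x' y z. True} \<union>
     {basis_vec (x, y + y', z) - basis_vec (x, y, z) - basis_vec (x, y', z) | x y y' z. True} \<union>
     {basis_vec (x, y, z + z') - basis_vec (x, y, z) - basis_vec (x, y, z') | x y z z'. True} \<union>
     {basis_vec (scal c x, y, z) - free_scale c (basis_vec (x, y, z)) | c x y z. True} \<union>
     {basis_vec (x, scal c y, z) - free_scale c (basis_vec (x, y, z)) | c x y z. True} \<union>
     {basis_vec (x, y, scal c z) - free_scale c (basis_vec (x, y, z)) | c x y z. True})"

abbreviation tensor2 :: "('k::field \<Rightarrow> 'a::ab_group_add \<Rightarrow> 'a) \<Rightarrow> ('a \<times> 'a \<Rightarrow>\<^sub>0 'k) set set" where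
  "tensor2 scal \<equiv> quot_space (null2 scal)"

type_synonym ('a, 'k) tens2 = "('a \<times> 'a \<Rightarrow>\<^sub>0 'k) set"
type_synonym ('a, 'k) tens3 = "('a \<times> 'a \<times> 'a \<Rightarrow>\<^sub>0 'k) set"


section \<open>Double Poisson brackets\<close>

definition flip2 ::
    "('k::field \<Rightarrow> 'a::ab_group_add \<Rightarrow> 'a) \<Rightarrow> ('a, 'k) tens2 \<Rightarrow> ('a, 'k) tens2" where
  "flip2 scal = quot_map (null2 scal) (\<lambda>(x', x''). basis_vec (x'', x'))"

definition map2 ::
    "('k::field \<Rightarrow> 'a::ab_group_add \<Rightarrow> 'a) \<Rightarrow> ('a \<Rightarrow> 'a) \<Rightarrow> ('a, 'k) tens2 \<Rightarrow> ('a, 'k) tens2" where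
  "map2 scal \<phi> = quot_map (null2 scal) (\<lambda>(x', x''). basis_vec (\<phi> x', \<phi> x''))"

definition rmult2 ::
    "('k::field \<Rightarrow> 'a::ring \<Rightarrow> 'a) \<Rightarrow> ('a, 'k) tens2 \<Rightarrow> 'a \<Rightarrow> ('a, 'k) tens2" where
  "rmult2 scal t c = quot_map (null2 scal) (\<lambda>(x', x''). basis_vec (x', x'' * c)) t"

definition lmult2 ::
    "('k::field \<Rightarrow> 'a::ring \<Rightarrow> 'a) \<Rightarrow> 'a \<Rightarrow> ('a, 'k) tens2 \<Rightarrow> ('a, 'k) tens2" where
  "lmult2 scal b t = quot_map (null2 scal) (\<lambda>(x', x''). basis_vec (b * x', x'')) t"

text \<open>The action of the cycle \<open>(123)\<close>.\<close>

definition rot3 ::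
    "('k::field \<Rightarrow> 'a::ab_group_add \<Rightarrow> 'a) \<Rightarrow> ('a, 'k) tens3 \<Rightarrow> ('a, 'k) tens3" where
  "rot3 scal = quot_map (null3 scal) (\<lambda>(x', x'', x'''). basis_vec (x''', x', x''))"

definition bracket_L ::
    "('k::field \<Rightarrow> 'a::ab_group_add \<Rightarrow> 'a) \<Rightarrow> ('a \<Rightarrow> 'a \<Rightarrow> ('a, 'k) tens2)
     \<Rightarrow> 'a \<Rightarrow> ('a, 'k) tens2 \<Rightarrow> ('a, 'k) tens3" where
  "bracket_L scal db a = quot_map (null3 scal)
     (\<lambda>(x', x''). linear_ext (\<lambda>(y', y''). basis_vec (y', y'', x'')) (coset_rep (db a x')))"

definition double_bracket ::
    "('k::field \<Rightarrow> 'a::{ring, monoid_mult} \<Rightarrow> 'a) \<Rightarrow> ('a \<Rightarrow> 'a \<Rightarrow> ('a, 'k) tens2) \<Rightarrow> bool" where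
  "double_bracket scal db \<longleftrightarrow>
     (\<forall>a b. db a b \<in> tensor2 scal) \<and>
     (\<forall>a a' b. db (a + a') b = db a b + db a' b) \<and>
     (\<forall>a b b'. db a (b + b') = db a b + db a b') \<and>
     (\<forall>c a b. db (scal c a) b = quot_scale (null2 scal) c (db a b)) \<and>
     (\<forall>c a b. db a (scal c b) = quot_scale (null2 scal) c (db a b)) \<and>
     (\<forall>a b. db a b = quot_scale (null2 scal) (-1) (flip2 scal (db b a))) \<and>
     (\<forall>a b c. db a (b * c) = rmult2 scal (db a b) c + lmult2 scal b (db a c))"

text \<open>The subspace \<open>null3 scal\<close> is the zero element of the third tensor power.\<close>

definition double_poisson_bracket ::
    "('k::field \<Rightarrow> 'a::{ring, monoid_mult} \<Rightarrow> 'a) \<Rightarrow> ('a \<Rightarrow> 'a \<Rightarrow> ('a, 'k) tens2) \<Rightarrow> bool" where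
  "double_poisson_bracket scal db \<longleftrightarrow>
     double_bracket scal db \<and>
     (\<forall>a b c. bracket_L scal db a (db b c)
        + rot3 scal (bracket_L scal db b (db c a))
        + rot3 scal (rot3 scal (bracket_L scal db c (db a b))) = null3 scal)"

definition adapted ::
    "('k::field \<Rightarrow> 'a::{ring, monoid_mult} \<Rightarrow> 'a) \<Rightarrow> ('a \<Rightarrow> 'a)
     \<Rightarrow> ('a \<Rightarrow> 'a \<Rightarrow> ('a, 'k) tens2) \<Rightarrow> bool" where
  "adapted scal \<phi> db \<longleftrightarrow> (\<forall>a b. map2 scal \<phi> (db a b) = flip2 scal (db (\<phi> a) (\<phi> b)))"


section \<open>Coordinate rings\<close>

text \<open>Polynomials over \<open>'k\<close> in the symbols \<open>a\<^bsub>ij\<^esub>\<close>, where \<open>a :: 'a\<close> and \<open>i\<close>, \<open>j\<close> range over the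
  finite index type \<open>'n\<close>.\<close>

type_synonym ('a, 'n, 'k) coord_poly = "('a \<times> 'n \<times> 'n \<Rightarrow>\<^sub>0 nat) \<Rightarrow>\<^sub>0 'k"

definition coord_var :: "'a \<Rightarrow> 'n \<Rightarrow> 'n \<Rightarrow> ('a, 'n, 'k::field) coord_poly" where
  "coord_var a i j = Poly_Mapping.single (Poly_Mapping.single (a, i, j) 1) 1"

definition coord_const :: "'k \<Rightarrow> ('a, 'n, 'k::field) coord_poly" where
  "coord_const c = Poly_Mapping.single 0 c"

definition coord_ideal ::
    "('k::field \<Rightarrow> 'a::{ring, monoid_mult} \<Rightarrow> 'a) \<Rightarrow> ('a, 'n::finite, 'k) coord_poly set" where
  "coord_ideal scal = genideal ring_of_type_algebra (
     {coord_var (a + b) i j - (coord_var a i j + coord_var b i j) | a b i j. True} \<union>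
     {coord_var (scal c a) i j - coord_const c * coord_var a i j | c a i j. True} \<union>
     {coord_var (a * b) i j - (\<Sum>r\<in>UNIV. coord_var a i r * coord_var b r j) | a b i j. True} \<union>
     {coord_var 1 i j - (if i = j then 1 else 0) | i j. True})"

definition coord_ring ::
    "('k::field \<Rightarrow> 'a::{ring, monoid_mult} \<Rightarrow> 'a) \<Rightarrow> ('a, 'n::finite, 'k) coord_poly set ring" where
  "coord_ring scal = ring_of_type_algebra Quot coord_ideal scal"

definition coord_class ::
    "('k::field \<Rightarrow> 'a::{ring, monoid_mult} \<Rightarrow> 'a) \<Rightarrow> ('a, 'n::finite, 'k) coord_poly
     \<Rightarrow> ('a, 'n, 'k) coord_poly set" where
  "coord_class scal p = coord_ideal scal +>\<^bsub>ring_of_type_algebra\<^esub> p"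

definition twisted_ideal ::
    "('k::field \<Rightarrow> 'a::{ring, monoid_mult} \<Rightarrow> 'a) \<Rightarrow> ('a \<Rightarrow> 'a)
     \<Rightarrow> ('k ^ 'n::finite ^ 'n \<Rightarrow> 'k ^ 'n ^ 'n) \<Rightarrow> ('a, 'n, 'k) coord_poly set set" where
  "twisted_ideal scal \<phi> \<tau> = genideal (coord_ring scal)
     {coord_class scal
        (coord_var (\<phi> a) i j -
         (\<Sum>m\<in>UNIV. \<Sum>n\<in>UNIV. coord_const (mcoeff \<tau> m n i j) * coord_var a m n))
      | a i j. True}"

definition twisted_ring ::
    "('k::field \<Rightarrow> 'a::{ring, monoid_mult} \<Rightarrow> 'a) \<Rightarrow> ('a \<Rightarrow> 'a)
     \<Rightarrow> ('k ^ 'n::finite ^ 'n \<Rightarrow> 'k ^ 'n ^ 'n) \<Rightarrow> ('a, 'n, 'k) coord_poly set set ring" where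
  "twisted_ring scal \<phi> \<tau> = coord_ring scal Quot twisted_ideal scal \<phi> \<tau>"

definition twisted_class ::
    "('k::field \<Rightarrow> 'a::{ring, monoid_mult} \<Rightarrow> 'a) \<Rightarrow> ('a \<Rightarrow> 'a)
     \<Rightarrow> ('k ^ 'n::finite ^ 'n \<Rightarrow> 'k ^ 'n ^ 'n) \<Rightarrow> ('a, 'n, 'k) coord_poly
     \<Rightarrow> ('a, 'n, 'k) coord_poly set set" where
  "twisted_class scal \<phi> \<tau> p = twisted_ideal scal \<phi> \<tau> +>\<^bsub>coord_ring scal\<^esub> coord_class scal p"

definition twisted_gen ::
    "('k::field \<Rightarrow> 'a::{ring, monoid_mult} \<Rightarrow> 'a) \<Rightarrow> ('a \<Rightarrow> 'a)
     \<Rightarrow> ('k ^ 'n::finite ^ 'n \<Rightarrow> 'k ^ 'n ^ 'n) \<Rightarrow> 'a \<Rightarrow> 'n \<Rightarrow> 'n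
     \<Rightarrow> ('a, 'n, 'k) coord_poly set set" where
  "twisted_gen scal \<phi> \<tau> a i j = twisted_class scal \<phi> \<tau> (coord_var a i j)"

definition twisted_smult ::
    "('k::field \<Rightarrow> 'a::{ring, monoid_mult} \<Rightarrow> 'a) \<Rightarrow> ('a \<Rightarrow> 'a)
     \<Rightarrow> ('k ^ 'n::finite ^ 'n \<Rightarrow> 'k ^ 'n ^ 'n) \<Rightarrow> 'k
     \<Rightarrow> ('a, 'n, 'k) coord_poly set set \<Rightarrow> ('a, 'n, 'k) coord_poly set set" where
  "twisted_smult scal \<phi> \<tau> c x =
     twisted_class scal \<phi> \<tau> (coord_const c) \<otimes>\<^bsub>twisted_ring scal \<phi> \<tau>\<^esub> x"

text \<open>For \<open>t = x' \<otimes> x''\<close> in Sweedler notation, \<open>sweedler_poly t i j k l\<close> represents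
  \<open>x'\<^bsub>ij\<^esub> x''\<^bsub>kl\<^esub>\<close>. Another representative of \<open>t\<close> changes it by an element of
  \<open>coord_ideal scal\<close>.\<close>

definition sweedler_poly ::
    "('a, 'k::field) tens2 \<Rightarrow> 'n \<Rightarrow> 'n \<Rightarrow> 'n \<Rightarrow> 'n \<Rightarrow> ('a, 'n, 'k) coord_poly" where
  "sweedler_poly t i j k l = linear_ext (\<lambda>(x', x''). coord_var x' i j * coord_var x'' k l) (coset_rep t)"


section \<open>Poisson brackets\<close>

definition poisson_bracket ::
    "('c, 'm) ring_scheme \<Rightarrow> ('k \<Rightarrow> 'c \<Rightarrow> 'c) \<Rightarrow> ('c \<Rightarrow> 'c \<Rightarrow> 'c) \<Rightarrow> bool" where
  "poisson_bracket R scl B \<longleftrightarrow>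
     B \<in> carrier R \<rightarrow> carrier R \<rightarrow> carrier R \<and>
     (\<forall>x\<in>carrier R. \<forall>y\<in>carrier R. \<forall>z\<in>carrier R.
        B (x \<oplus>\<^bsub>R\<^esub> y) z = B x z \<oplus>\<^bsub>R\<^esub> B y z \<and>
        B x (y \<oplus>\<^bsub>R\<^esub> z) = B x y \<oplus>\<^bsub>R\<^esub> B x z) \<and>
     (\<forall>c. \<forall>x\<in>carrier R. \<forall>y\<in>carrier R.
        B (scl c x) y = scl c (B x y) \<and> B x (scl c y) = scl c (B x y)) \<and>
     (\<forall>x\<in>carrier R. B x x = \<zero>\<^bsub>R\<^esub>) \<and>
     (\<forall>x\<in>carrier R. \<forall>y\<in>carrier R. \<forall>z\<in>carrier R.
        B x (B y z) \<oplus>\<^bsub>R\<^esub> B y (B z x) \<oplus>\<^bsub>R\<^esub> B z (B x y) = \<zero>\<^bsub>R\<^esub>) \<and>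
     (\<forall>x\<in>carrier R. \<forall>y\<in>carrier R. \<forall>z\<in>carrier R.
        B x (y \<otimes>\<^bsub>R\<^esub> z) = B x y \<otimes>\<^bsub>R\<^esub> z \<oplus>\<^bsub>R\<^esub> y \<otimes>\<^bsub>R\<^esub> B x z \<and>
        B (x \<otimes>\<^bsub>R\<^esub> y) z = B x z \<otimes>\<^bsub>R\<^esub> y \<oplus>\<^bsub>R\<^esub> x \<otimes>\<^bsub>R\<^esub> B y z)"

end

theory Submission
  imports Defs
begin

text \<open>All computations take place in the polynomial ring \<open>P\<close> in the symbols \<open>a\<^bsub>ij\<^esub>\<close>, modulo two ideals
  \<open>I \<subseteq> J\<close>: the quotient by \<open>I\<close> is the coordinate ring of \<open>A\<close>, the quotient by \<open>J\<close> is the twisted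
  one. Three facts carry the theorem.

  Van den Bergh's bracket. Let \<open>[-,-]\<close> be the biderivation of \<open>P\<close> with
  \<open>[a\<^bsub>ij\<^esub>, b\<^bsub>kl\<^esub>] = \<lbrace>a,b\<rbrace>'\<^bsub>kj\<^esub> \<lbrace>a,b\<rbrace>''\<^bsub>il\<^esub>\<close>. It induces a Poisson bracket on \<open>P / I\<close>. The symmetry
  and the Leibniz rule of the double bracket give antisymmetry and the stability of \<open>I\<close>. On
  generators the Jacobi sum of \<open>a\<close>, \<open>b\<close>, \<open>c\<close> is the difference of two evaluations of the double
  Jacobi identity, one for \<open>(a, b, c)\<close> and one for \<open>(a, c, b)\<close> (lemmas \<open>vdb_nested\<close> and
  \<open>poisson_mod_vdb\<close>).

  The involution. Let \<open>\<theta>\<close> be the endomorphism of \<open>P\<close> with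
  \<open>\<theta> a\<^bsub>ij\<^esub> = \<Sum>\<^bsub>mn\<^esub> \<tau>\<^bsub>mn\<^esub>\<^bsup>ij\<^esup> \<phi>(a)\<^bsub>mn\<^esub>\<close>; if \<open>X(a)\<close> is the matrix of the \<open>a\<^bsub>ij\<^esub>\<close>, it replaces \<open>X(a)\<close> by
  \<open>\<tau>(X(\<phi> a))\<close>. Then \<open>\<theta>\<^sup>2 = 1\<close>, and \<open>J\<close> is generated by \<open>I\<close> and all \<open>\<theta> p - p\<close>. Moreover \<open>\<theta>\<close> preserves
  \<open>[-,-]\<close> modulo \<open>I\<close>: adaptedness turns the double bracket of \<open>\<phi> a\<close> and \<open>\<phi> b\<close> into the flipped image of
  that of \<open>a\<close> and \<open>b\<close>, and the remaining identity
  \<open>\<tau>\<^bsub>mn\<^esub>\<^bsup>ij\<^esup> \<tau>\<^bsub>pq\<^esub>\<^bsup>kl\<^esup> = \<tau>\<^bsub>mq\<^esub>\<^bsup>kj\<^esup> \<tau>\<^bsub>pn\<^esub>\<^bsup>il\<^esup>\<close> (lemma \<open>mcoeff_exchange\<close>) holds because an anti-automorphism of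
  the matrix algebra preserves the trace.

  Reduction. If an involution \<open>\<theta>\<close> preserves a Poisson bracket, then \<open>{f, g} = [f + \<theta> f, g]\<close> defines a
  Poisson bracket on the coinvariants. Indeed \<open>u = f + \<theta> f\<close> is invariant, so
  \<open>[u, \<theta> g] = \<theta> [u, g]\<close>, which agrees with \<open>[u, g]\<close> in the coinvariants; and the Jacobi identity for
  \<open>f\<close>, \<open>g\<close>, \<open>h\<close> is the one of \<open>[-,-]\<close> for \<open>f + \<theta> f\<close>, \<open>g + \<theta> g\<close>, \<open>h\<close> (locale \<open>poisson_reduction\<close>).

  On generators the reduced bracket is the formula of the theorem. Since the generators determine a
  bracket that is a derivation in each argument, it is the only one.\<close>

section \<open>Ideals and Poisson brackets modulo an ideal\<close>

text \<open>The ideals of a commutative ring are the subspaces of the ring as a module over itself, so the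
  theory of subspaces and spans applies to them.\<close>

global_interpretation regular: Modules.module "(*) :: 'r::comm_ring_1 \<Rightarrow> 'r \<Rightarrow> 'r"
  by standard (simp_all add: algebra_simps)

(* As a simplification rule, \<open>a * (b * x) = (a * b) * x\<close> loops with associativity. *)
declare regular.scale_scale [simp del]

abbreviation is_ideal :: "'r::comm_ring_1 set \<Rightarrow> bool" where
  "is_ideal \<equiv> Modules.module.subspace (*)"

abbreviation ideal_hull :: "'r::comm_ring_1 set \<Rightarrow> 'r set" where
  "ideal_hull \<equiv> Modules.module.span (*)"

definition cong_mod :: "'r::comm_ring_1 set \<Rightarrow> 'r \<Rightarrow> 'r \<Rightarrow> bool" where
  "cong_mod I x y \<longleftrightarrow> x - y \<in> I"

context
  fixes I :: "'r::comm_ring_1 set"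
  assumes I: "is_ideal I"
begin

lemma cong_mod_refl [simp]: "cong_mod I x x"
  using I by (simp add: cong_mod_def regular.subspace_0)

lemma cong_mod_sym: "cong_mod I x y \<Longrightarrow> cong_mod I y x"
  using regular.subspace_neg[OF I] unfolding cong_mod_def by force

lemma cong_mod_trans [trans]: "cong_mod I x y \<Longrightarrow> cong_mod I y z \<Longrightarrow> cong_mod I x z"
  using regular.subspace_add[OF I, of "x - y" "y - z"] by (simp add: cong_mod_def)

lemma cong_mod_add: "cong_mod I x y \<Longrightarrow> cong_mod I x' y' \<Longrightarrow> cong_mod I (x + x') (y + y')"
  using regular.subspace_add[OF I, of "x - y" "x' - y'"] by (simp add: cong_mod_def algebra_simps)

lemma cong_mod_uminus: "cong_mod I x y \<Longrightarrow> cong_mod I (- x) (- y)"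
  using regular.subspace_neg[OF I, of "x - y"] by (simp add: cong_mod_def algebra_simps)

lemma cong_mod_diff: "cong_mod I x y \<Longrightarrow> cong_mod I x' y' \<Longrightarrow> cong_mod I (x - x') (y - y')"
  using cong_mod_add[of x y "- x'" "- y'"] cong_mod_uminus by simp

lemma cong_mod_mult: "cong_mod I x y \<Longrightarrow> cong_mod I x' y' \<Longrightarrow> cong_mod I (x * x') (y * y')"
  using regular.subspace_add[OF I regular.subspace_scale[OF I, of "x' - y'" x]
      regular.subspace_scale[OF I, of "x - y" y']]
  by (simp add: cong_mod_def algebra_simps)

lemma cong_mod_sum: "(\<And>i. i \<in> S \<Longrightarrow> cong_mod I (f i) (g i)) \<Longrightarrow> cong_mod I (sum f S) (sum g S)"
  using regular.subspace_sum[OF I, of S "\<lambda>i. f i - g i"] by (simp add: cong_mod_def sum_subtractf)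

lemma cong_mod_0_iff: "cong_mod I x 0 \<longleftrightarrow> x \<in> I"
  by (simp add: cong_mod_def)

lemma cong_mod_mem: "cong_mod I x y \<Longrightarrow> x \<in> I \<longleftrightarrow> y \<in> I"
  using cong_mod_sym cong_mod_trans cong_mod_0_iff by metis

end

lemma cong_mod_mono: "cong_mod I x y \<Longrightarrow> I \<subseteq> J \<Longrightarrow> cong_mod J x y"
  by (auto simp: cong_mod_def)

locale biderivation =
  fixes B :: "'r::comm_ring_1 \<Rightarrow> 'r \<Rightarrow> 'r"
  assumes add_left: "B (x + y) z = B x z + B y z"
    and add_right: "B x (y + z) = B x y + B x z"
    and mult_left: "B (x * y) z = x * B y z + y * B x z"
    and mult_right: "B x (y * z) = y * B x z + z * B x y"
begin

lemma zero_right [simp]: "B y 0 = 0" using add_right[of y 0 0] by simp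
lemma one_right [simp]: "B y 1 = 0" using mult_right[of y 1 1] by simp
lemma uminus_right: "B y (- x) = - B y x" using add_right[of y x "- x"] by (simp add: minus_unique)
lemma diff_right: "B y (x - x') = B y x - B y x'" using add_right[of y x "- x'"] by (simp add: uminus_right)
lemma zero_left [simp]: "B 0 y = 0" using add_left[of 0 0 y] by simp
lemma sum_left: "B (sum f S) y = (\<Sum>s\<in>S. B (f s) y)"
  by (induction S rule: infinite_finite_induct) (simp_all add: add_left)
lemma sum_right: "B y (sum f S) = (\<Sum>s\<in>S. B y (f s))"
  by (induction S rule: infinite_finite_induct) (simp_all add: add_right)

text \<open>The derivation \<open>B x\<close> thus preserves an ideal as soon as it sends generators of the ideal into it.\<close>

lemma is_ideal_stabilizer:
  assumes J: "is_ideal J"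
  shows "is_ideal {y \<in> J. B x y \<in> J}"
proof (rule regular.subspaceI)
  fix c y assume y: "y \<in> {y \<in> J. B x y \<in> J}"
  then have "c * B x y + B x c * y \<in> J" "c * y \<in> J"
    by (auto intro!: regular.subspace_add regular.subspace_scale J)
  then show "c * y \<in> {y \<in> J. B x y \<in> J}"
    by (simp add: mult_right mult.commute)
qed (auto simp: add_right intro: regular.subspace_0 regular.subspace_add J)

end

text \<open>A Poisson bracket on the quotient by \<open>I\<close>, given by a lift \<open>B\<close> to the ring itself. The axioms
  for the first argument follow from those for the second by antisymmetry.\<close>

locale poisson_mod =
  fixes I :: "'r::comm_ring_1 set" and B :: "'r \<Rightarrow> 'r \<Rightarrow> 'r"
  assumes ideal: "is_ideal I"
    and cong_right: "cong_mod I y y' \<Longrightarrow> cong_mod I (B x y) (B x y')"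
    and plus_right: "cong_mod I (B x (y + z)) (B x y + B x z)"
    and times_right: "cong_mod I (B x (y * z)) (B x y * z + y * B x z)"
    and antisym: "cong_mod I (B x y) (- B y x)"
    and jacobi: "cong_mod I (B x (B y z) + B y (B z x) + B z (B x y)) 0"
begin

lemmas cm_refl = cong_mod_refl[OF ideal]
  and cm_sym = cong_mod_sym[OF ideal] and cm_trans [trans] = cong_mod_trans[OF ideal]
  and cm_add = cong_mod_add[OF ideal] and cm_uminus = cong_mod_uminus[OF ideal]
  and cm_mult = cong_mod_mult[OF ideal]

lemma cong_left:
  assumes "cong_mod I x x'"
  shows "cong_mod I (B x y) (B x' y)"
proof -
  have "cong_mod I (B x y) (- B y x)" by (rule antisym)
  also have "cong_mod I (- B y x) (- B y x')" by (intro cm_uminus cong_right assms)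
  also have "cong_mod I (- B y x') (B x' y)" by (rule cm_sym[OF antisym])
  finally show ?thesis .
qed

lemma plus_left: "cong_mod I (B (x + y) z) (B x z + B y z)"
proof -
  have "cong_mod I (B (x + y) z) (- B z (x + y))" by (rule antisym)
  also have "cong_mod I (- B z (x + y)) (- B z x + - B z y)"
    using cm_uminus[OF plus_right[of z x y]] by simp
  also have "cong_mod I (- B z x + - B z y) (B x z + B y z)"
    by (intro cm_add cm_sym[OF antisym])
  finally show ?thesis .
qed

lemma times_left: "cong_mod I (B (x * y) z) (B x z * y + x * B y z)"
proof -
  have "cong_mod I (B (x * y) z) (- B z (x * y))" by (rule antisym)
  also have "cong_mod I (- B z (x * y)) (- B z x * y + x * - B z y)"
    using cm_uminus[OF times_right[of z x y]] by simp
  also have "cong_mod I (- B z x * y + x * - B z y) (B x z * y + x * B y z)"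
    by (intro cm_add cm_mult cm_refl cm_sym[OF antisym])
  finally show ?thesis .
qed

end

section \<open>Reduction of a Poisson bracket to the coinvariants of an involution\<close>

text \<open>The bracket is preserved by \<open>\<theta>\<close> only modulo \<open>I\<close>, whereas \<open>\<theta>\<close> is an involution of the ring
  itself. This is the situation of a free ring that maps onto the ring of interest.\<close>

locale poisson_reduction = biderivation B + poisson_mod I B
  for I :: "'r::comm_ring_1 set" and B +
  fixes \<theta> :: "'r \<Rightarrow> 'r"
  assumes \<theta>_add: "\<theta> (x + y) = \<theta> x + \<theta> y"
    and \<theta>_mult: "\<theta> (x * y) = \<theta> x * \<theta> y"
    and \<theta>_involutive: "\<theta> (\<theta> x) = x"
    and \<theta>_poisson: "cong_mod I (B (\<theta> x) (\<theta> y)) (\<theta> (B x y))"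
begin

definition coinv_ideal :: "'r set" where
  "coinv_ideal = ideal_hull (I \<union> range (\<lambda>x. \<theta> x - x))"

definition reduced :: "'r \<Rightarrow> 'r \<Rightarrow> 'r" where
  "reduced x y = B (x + \<theta> x) y"

lemma coinv_ideal: "is_ideal coinv_ideal"
  by (simp add: coinv_ideal_def)

lemma ideal_le_coinv: "I \<subseteq> coinv_ideal"
  unfolding coinv_ideal_def using regular.span_superset by blast

lemma \<theta>_cong: "cong_mod coinv_ideal (\<theta> x) x"
  unfolding cong_mod_def coinv_ideal_def by (rule regular.span_base) auto

lemmas J_refl = cong_mod_refl[OF coinv_ideal]
  and J_sym = cong_mod_sym[OF coinv_ideal] and J_trans [trans] = cong_mod_trans[OF coinv_ideal]
  and J_add = cong_mod_add[OF coinv_ideal]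

lemma cong_I_J: "cong_mod I x y \<Longrightarrow> cong_mod coinv_ideal x y"
  using cong_mod_mono ideal_le_coinv by blast

text \<open>Since \<open>x + \<theta> x\<close> is fixed by \<open>\<theta>\<close>, bracketing with it commutes with \<open>\<theta>\<close>.\<close>

lemma bracket_invariant:
  "cong_mod I (\<theta> (B (x + \<theta> x) y)) (B (x + \<theta> x) (\<theta> y))"
proof -
  have "\<theta> (x + \<theta> x) = x + \<theta> x"
    by (simp add: \<theta>_add \<theta>_involutive add.commute)
  then show ?thesis
    using cm_sym[OF \<theta>_poisson[of "x + \<theta> x" y]] by simp
qed

text \<open>The ideal of the coinvariants is generated by \<open>I\<close>, which every \<open>B u\<close> preserves, and by the
  elements \<open>\<theta> z - z\<close>, which \<open>B u\<close> sends to \<open>\<theta> (B u z) - B u z\<close> modulo \<open>I\<close> if \<open>u = x + \<theta> x\<close>.\<close>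

lemma reduced_cong_right:
  assumes "cong_mod coinv_ideal y y'"
  shows "cong_mod coinv_ideal (reduced x y) (reduced x y')"
proof -
  let ?K = "{y \<in> coinv_ideal. B (x + \<theta> x) y \<in> coinv_ideal}"
  have "is_ideal ?K"
    by (rule is_ideal_stabilizer[OF coinv_ideal])
  moreover have "I \<subseteq> ?K"
    using cong_right[of _ 0 "x + \<theta> x"] ideal_le_coinv
    by (auto simp: cong_mod_def reduced_def)
  moreover have "\<theta> z - z \<in> ?K" for z
  proof -
    have "cong_mod coinv_ideal (B (x + \<theta> x) (\<theta> z)) (\<theta> (B (x + \<theta> x) z))"
      by (rule cong_I_J[OF cm_sym[OF bracket_invariant]])
    also have "cong_mod coinv_ideal (\<theta> (B (x + \<theta> x) z)) (B (x + \<theta> x) z)"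
      by (rule \<theta>_cong)
    finally show ?thesis
      using \<theta>_cong[of z] by (simp add: reduced_def diff_right cong_mod_def)
  qed
  ultimately have "ideal_hull (I \<union> range (\<lambda>z. \<theta> z - z)) \<subseteq> ?K"
    by (intro regular.span_minimal Un_least image_subsetI)
  then have "coinv_ideal \<subseteq> ?K"
    by (simp only: coinv_ideal_def[symmetric])
  then have "B (x + \<theta> x) (y - y') \<in> coinv_ideal"
    using assms unfolding cong_mod_def by blast
  then show ?thesis
    by (simp add: cong_mod_def reduced_def diff_right)
qed

text \<open>In the coinvariants \<open>B (\<theta> x) y\<close> equals \<open>\<theta> (B (\<theta> x) y)\<close>, that is \<open>B x (\<theta> y)\<close>; hence symmetrizing
  the first argument has the same effect as symmetrizing the second.\<close>

lemma reduced_antisym: "cong_mod coinv_ideal (reduced x y) (- reduced y x)"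
proof -
  have "cong_mod coinv_ideal (B (\<theta> x) y) (\<theta> (B (\<theta> x) y))"
    by (rule J_sym[OF \<theta>_cong])
  also have "cong_mod coinv_ideal (\<theta> (B (\<theta> x) y)) (B x (\<theta> y))"
    using cong_I_J[OF cm_sym[OF \<theta>_poisson[of "\<theta> x" y]]] by (simp add: \<theta>_involutive)
  finally have "cong_mod coinv_ideal (B (\<theta> x) y) (B x (\<theta> y))" .
  from J_add[OF J_refl[of "B x y"] this]
  have "cong_mod coinv_ideal (reduced x y) (B x (y + \<theta> y))"
    by (simp add: reduced_def add_left add_right)
  also have "cong_mod coinv_ideal (B x (y + \<theta> y)) (- reduced y x)"
    unfolding reduced_def by (rule cong_I_J[OF antisym])
  finally show ?thesis .
qed

lemma reduced_plus_right: "reduced x (y + z) = reduced x y + reduced x z"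
  by (simp add: reduced_def add_right)

lemma reduced_times_right: "reduced x (y * z) = reduced x y * z + y * reduced x z"
  by (simp add: reduced_def mult_right algebra_simps)

text \<open>With \<open>u = x + \<theta> x\<close> and \<open>v = y + \<theta> y\<close> the three summands become \<open>B u (B v z)\<close>, \<open>B v (B z u)\<close> and
  \<open>B z (B u v)\<close>. In the last one the symmetrization of \<open>B u y\<close> is \<open>B u v\<close>, by
  \<open>bracket_invariant\<close>.\<close>

lemma reduced_jacobi:
  "cong_mod coinv_ideal (reduced x (reduced y z) + reduced y (reduced z x) + reduced z (reduced x y)) 0"
proof -
  define u v where "u = x + \<theta> x" and "v = y + \<theta> y"
  have uminus_right': "reduced a (- b) = - reduced a b" for a b
    by (simp add: reduced_def uminus_right)
  have 1: "cong_mod coinv_ideal (reduced y (reduced z x)) (B v (B z u))"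
  proof -
    have "cong_mod coinv_ideal (reduced y (reduced z x)) (reduced y (- reduced x z))"
      by (rule reduced_cong_right[OF reduced_antisym])
    also have "reduced y (- reduced x z) = B v (- B u z)"
      by (simp add: reduced_def u_def v_def)
    also have "cong_mod coinv_ideal (B v (- B u z)) (B v (B z u))"
      by (rule cong_I_J[OF cong_right[OF cm_sym[OF antisym]]])
    finally show ?thesis .
  qed
  have 2: "cong_mod coinv_ideal (reduced z (reduced x y)) (B z (B u v))"
  proof -
    have "cong_mod coinv_ideal (reduced z (reduced x y)) (- reduced (reduced x y) z)"
      by (rule reduced_antisym)
    also have "- reduced (reduced x y) z = - B (B u y + \<theta> (B u y)) z"
      by (simp add: reduced_def u_def)
    also have "cong_mod coinv_ideal \<dots> (- B (B u y + B u (\<theta> y)) z)"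
      unfolding u_def
      by (intro cong_I_J cm_uminus cong_left cm_add cm_refl bracket_invariant)
    also have "- B (B u y + B u (\<theta> y)) z = - B (B u v) z"
      by (simp add: v_def add_right)
    also have "cong_mod coinv_ideal \<dots> (B z (B u v))"
      by (rule cong_I_J[OF cm_sym[OF antisym]])
    finally show ?thesis .
  qed
  have "reduced x (reduced y z) = B u (B v z)"
    by (simp add: reduced_def u_def v_def)
  then have "cong_mod coinv_ideal (reduced x (reduced y z) + reduced y (reduced z x) + reduced z (reduced x y))
     (B u (B v z) + B v (B z u) + B z (B u v))"
    by (intro J_add 1 2) (simp add: J_refl)
  also have "cong_mod coinv_ideal \<dots> 0"
    by (rule cong_I_J[OF jacobi])
  finally show ?thesis .
qed

lemma reduced_poisson_mod: "poisson_mod coinv_ideal reduced"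
  by standard (simp_all add: coinv_ideal reduced_cong_right reduced_antisym reduced_jacobi
      reduced_plus_right reduced_times_right J_refl)

end

section \<open>Homomorphisms and derivations of polynomial rings\<close>

lemma poly_mapping_sum_single:
  fixes x :: "'b \<Rightarrow>\<^sub>0 'c::comm_monoid_add"
  shows "x = (\<Sum>b\<in>Poly_Mapping.keys x. Poly_Mapping.single b (Poly_Mapping.lookup x b))"
  by (rule poly_mapping_eqI)
    (auto simp: lookup_sum lookup_single when_def in_keys_iff sum.delta)

lemma poly_mapping_single_induct [case_names zero add single]:
  fixes x :: "'b \<Rightarrow>\<^sub>0 'c::comm_monoid_add"
  assumes "P 0" and "\<And>x y. P x \<Longrightarrow> P y \<Longrightarrow> P (x + y)" and "\<And>b c. P (Poly_Mapping.single b c)"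
  shows "P x"
proof -
  have "P (\<Sum>b\<in>S. Poly_Mapping.single b (Poly_Mapping.lookup x b))" for S
    by (induction S rule: infinite_finite_induct) (auto intro: assms)
  then show ?thesis
    using poly_mapping_sum_single[of x] by metis
qed

definition eval_monomial :: "('v \<Rightarrow> 'r::comm_ring_1) \<Rightarrow> ('v \<Rightarrow>\<^sub>0 nat) \<Rightarrow> 'r" where
  "eval_monomial f m = (\<Prod>v\<in>Poly_Mapping.keys m. f v ^ Poly_Mapping.lookup m v)"

lemma eval_monomial_superset:
  assumes "finite S" "Poly_Mapping.keys m \<subseteq> S"
  shows "eval_monomial f m = (\<Prod>v\<in>S. f v ^ Poly_Mapping.lookup m v)"
  unfolding eval_monomial_def using assms
  by (intro prod.mono_neutral_left) (auto simp: in_keys_iff)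

lemma eval_monomial_add: "eval_monomial f (m + m') = eval_monomial f m * eval_monomial f m'"
  by (simp add: eval_monomial_superset[of "Poly_Mapping.keys m \<union> Poly_Mapping.keys m'"]
      Poly_Mapping.keys_add lookup_add power_add prod.distrib)

lemma eval_monomial_0 [simp]: "eval_monomial f 0 = 1"
  by (simp add: eval_monomial_def)

lemma eval_monomial_single [simp]: "eval_monomial f (Poly_Mapping.single v n) = f v ^ n"
  by (simp add: eval_monomial_def)

definition poly_eval ::
    "('k \<Rightarrow> 'r) \<Rightarrow> ('v \<Rightarrow> 'r) \<Rightarrow> (('v \<Rightarrow>\<^sub>0 nat) \<Rightarrow>\<^sub>0 'k::field) \<Rightarrow> 'r::comm_ring_1" where
  "poly_eval h f p = (\<Sum>m\<in>Poly_Mapping.keys p. h (Poly_Mapping.lookup p m) * eval_monomial f m)"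

context
  fixes h :: "'k::field \<Rightarrow> 'r::comm_ring_1"
  assumes h_add: "\<And>c d. h (c + d) = h c + h d"
    and h_mult: "\<And>c d. h (c * d) = h c * h d"
    and h_one: "h 1 = 1"
begin

lemma h_zero [simp]: "h 0 = 0"
  using h_add[of 0 0] by simp

lemma poly_eval_superset:
  assumes "finite S" "Poly_Mapping.keys p \<subseteq> S"
  shows "poly_eval h f p = (\<Sum>m\<in>S. h (Poly_Mapping.lookup p m) * eval_monomial f m)"
  unfolding poly_eval_def using assms
  by (intro sum.mono_neutral_left) (auto simp: in_keys_iff)

lemma poly_eval_add: "poly_eval h f (p + q) = poly_eval h f p + poly_eval h f q"
  by (simp add: poly_eval_superset[of "Poly_Mapping.keys p \<union> Poly_Mapping.keys q"]
      Poly_Mapping.keys_add lookup_add h_add distrib_right sum.distrib)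

lemma poly_eval_single: "poly_eval h f (Poly_Mapping.single m c) = h c * eval_monomial f m"
  by (cases "c = 0") (simp_all add: poly_eval_def)

lemma poly_eval_coord_const: "poly_eval h f (coord_const c) = h c"
  by (simp add: coord_const_def poly_eval_single)

lemma poly_eval_coord_var: "poly_eval h f (coord_var a i j) = f (a, i, j)"
  by (simp add: coord_var_def poly_eval_single h_one)

lemma poly_eval_zero: "poly_eval h f 0 = 0"
  by (simp add: poly_eval_def)

lemma poly_eval_mult: "poly_eval h f (p * q) = poly_eval h f p * poly_eval h f q"
proof (induction p rule: poly_mapping_single_induct)
  case (single m c)
  show ?case
  proof (induction q rule: poly_mapping_single_induct)
    case (single m' c')
    then show ?case
      by (simp add: mult_single poly_eval_single h_mult eval_monomial_add mult_ac)
  qed (simp_all add: poly_eval_zero poly_eval_add distrib_left)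
qed (simp_all add: poly_eval_zero poly_eval_add distrib_right)

end

text \<open>From here on the variables are the symbols \<open>a\<^bsub>ij\<^esub>\<close>.\<close>

lemma coord_const_add: "coord_const (c + d) = coord_const c + coord_const d"
  by (simp add: coord_const_def single_add)

lemma coord_const_mult: "coord_const (c * d) = coord_const c * coord_const d"
  by (simp add: coord_const_def mult_single)

lemma coord_const_1 [simp]: "coord_const 1 = 1"
  by (simp add: coord_const_def)

lemma coord_const_0 [simp]: "coord_const 0 = 0"
  by (simp add: coord_const_def)

lemma coord_const_sum: "coord_const (sum f S) = (\<Sum>s\<in>S. coord_const (f s))"
  by (induction S rule: infinite_finite_induct) (simp_all add: coord_const_add)

lemma coord_poly_induct [case_names const var add mult]:
  fixes p :: "('a, 'n, 'k::field) coord_poly"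
  assumes const: "\<And>c. Q (coord_const c)"
    and var: "\<And>a i j. Q (coord_var a i j)"
    and add: "\<And>p q. Q p \<Longrightarrow> Q q \<Longrightarrow> Q (p + q)"
    and mult: "\<And>p q. Q p \<Longrightarrow> Q q \<Longrightarrow> Q (p * q)"
  shows "Q p"
proof (induction p rule: poly_mapping_single_induct)
  case zero
  then show ?case using const[of 0] by simp
next
  case (single m c)
  have "Q (Poly_Mapping.single m 1)"
  proof (induction m rule: poly_mapping_single_induct)
    case zero
    then show ?case using const[of 1] by simp
  next
    case (add x y)
    then show ?case using mult by (force simp: mult_single)
  next
    case (single v n)
    show ?case
    proof (induction n)
      case 0
      then show ?case using const[of 1] by simp
    next
      case (Suc n)
      obtain a i j where v: "v = (a, i, j)" by (cases v) auto
      have "Poly_Mapping.single (Poly_Mapping.single v (Suc n)) (1::'k)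
          = coord_var a i j * Poly_Mapping.single (Poly_Mapping.single v n) 1"
        by (simp add: coord_var_def mult_single v flip: single_add)
      then show ?case using mult[OF var Suc] by simp
    qed
  qed
  then have "Q (coord_const c * Poly_Mapping.single m 1)" using mult const by blast
  then show ?case by (simp add: coord_const_def mult_single)
qed (rule add)

definition coord_hom ::
    "('a \<Rightarrow> 'n \<Rightarrow> 'n \<Rightarrow> ('a, 'n, 'k::field) coord_poly) \<Rightarrow> ('a, 'n, 'k) coord_poly \<Rightarrow> ('a, 'n, 'k) coord_poly" where
  "coord_hom f = poly_eval coord_const (\<lambda>(a, i, j). f a i j)"

lemma coord_hom_add: "coord_hom f (p + q) = coord_hom f p + coord_hom f q"
  unfolding coord_hom_def by (rule poly_eval_add) (simp_all add: coord_const_add coord_const_mult)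

lemma coord_hom_mult: "coord_hom f (p * q) = coord_hom f p * coord_hom f q"
  unfolding coord_hom_def by (rule poly_eval_mult) (simp_all add: coord_const_add coord_const_mult)

lemma coord_hom_const [simp]: "coord_hom f (coord_const c) = coord_const c"
  unfolding coord_hom_def
  by (subst poly_eval_coord_const) (simp_all add: coord_const_add coord_const_mult)

lemma coord_hom_var [simp]: "coord_hom f (coord_var a i j) = f a i j"
  unfolding coord_hom_def
  by (subst poly_eval_coord_var) (simp_all add: coord_const_add coord_const_mult)

lemma coord_hom_zero [simp]: "coord_hom f 0 = 0"
  using coord_hom_const[of f 0] by simp

lemma coord_hom_sum: "coord_hom f (sum g S) = (\<Sum>s\<in>S. coord_hom f (g s))"
  by (induction S rule: infinite_finite_induct) (simp_all add: coord_hom_add)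

text \<open>A derivation \<open>D\<close> of \<open>P\<close> is the same as a ring homomorphism \<open>p \<mapsto> p + \<epsilon> D p\<close> to the dual numbers
  over \<open>P\<close>. So a derivation with prescribed values on the variables arises from evaluation at
  \<open>a\<^bsub>ij\<^esub> + \<epsilon> f(a, i, j)\<close>. The univariate polynomials over \<open>P\<close> replace the dual numbers here: the
  coefficients of degree at least two are ignored.\<close>

definition dual_hom ::
    "('a \<Rightarrow> 'n \<Rightarrow> 'n \<Rightarrow> ('a, 'n, 'k::field) coord_poly) \<Rightarrow> ('a, 'n, 'k) coord_poly \<Rightarrow> ('a, 'n, 'k) coord_poly poly" where
  "dual_hom f = poly_eval (\<lambda>c. [:coord_const c:]) (\<lambda>(a, i, j). [:coord_var a i j, f a i j:])"

lemma dual_hom_add: "dual_hom f (p + q) = dual_hom f p + dual_hom f q"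
  unfolding dual_hom_def by (rule poly_eval_add) (simp_all add: coord_const_add coord_const_mult)

lemma dual_hom_mult: "dual_hom f (p * q) = dual_hom f p * dual_hom f q"
  unfolding dual_hom_def by (rule poly_eval_mult) (simp_all add: coord_const_add coord_const_mult)

lemma dual_hom_const: "dual_hom f (coord_const c) = [:coord_const c:]"
  unfolding dual_hom_def
  by (subst poly_eval_coord_const) (simp_all add: coord_const_add coord_const_mult)

lemma dual_hom_var: "dual_hom f (coord_var a i j) = [:coord_var a i j, f a i j:]"
  unfolding dual_hom_def
  by (subst poly_eval_coord_var) (simp_all add: coord_const_add coord_const_mult)

lemma coeff_dual_hom_0: "coeff (dual_hom f p) 0 = p"
  by (induction p rule: coord_poly_induct)
    (simp_all add: dual_hom_const dual_hom_var dual_hom_add dual_hom_mult coeff_mult)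

definition deriv_ext ::
    "('a \<Rightarrow> 'n \<Rightarrow> 'n \<Rightarrow> ('a, 'n, 'k::field) coord_poly) \<Rightarrow> ('a, 'n, 'k) coord_poly \<Rightarrow> ('a, 'n, 'k) coord_poly" where
  "deriv_ext f p = coeff (dual_hom f p) 1"

lemma deriv_ext_add: "deriv_ext f (p + q) = deriv_ext f p + deriv_ext f q"
  by (simp add: deriv_ext_def dual_hom_add)

lemma deriv_ext_mult: "deriv_ext f (p * q) = p * deriv_ext f q + q * deriv_ext f p"
  by (simp add: deriv_ext_def dual_hom_mult coeff_mult coeff_dual_hom_0 mult.commute)

lemma deriv_ext_const [simp]: "deriv_ext f (coord_const c) = 0"
  by (simp add: deriv_ext_def dual_hom_const)

lemma deriv_ext_var [simp]: "deriv_ext f (coord_var a i j) = f a i j"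
  by (simp add: deriv_ext_def dual_hom_var)

lemma deriv_ext_fun_zero: "deriv_ext (\<lambda>a i j. 0) p = 0"
  by (induction p rule: coord_poly_induct) (simp_all add: deriv_ext_add deriv_ext_mult)

text \<open>The derivations of \<open>P\<close> form a module over \<open>P\<close>, and a derivation depends linearly on its values on
  the variables.\<close>

lemma deriv_ext_fun_linear:
  "deriv_ext (\<lambda>a i j. x * f a i j + y * g a i j) p = x * deriv_ext f p + y * deriv_ext g p"
  by (induction p rule: coord_poly_induct)
    (simp_all add: deriv_ext_add deriv_ext_mult algebra_simps)

text \<open>The biderivation with given values on pairs of variables: \<open>q\<close> is differentiated along \<open>F a i j\<close> for
  each variable, and the results are the values of the derivation that is applied to \<open>p\<close>.\<close>

definition coord_bracket ::
    "('a \<Rightarrow> 'n \<Rightarrow> 'n \<Rightarrow> 'a \<Rightarrow> 'n \<Rightarrow> 'n \<Rightarrow> ('a, 'n, 'k::field) coord_poly)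
     \<Rightarrow> ('a, 'n, 'k) coord_poly \<Rightarrow> ('a, 'n, 'k) coord_poly \<Rightarrow> ('a, 'n, 'k) coord_poly" where
  "coord_bracket F p q = deriv_ext (\<lambda>a i j. deriv_ext (F a i j) q) p"

lemma coord_bracket_var: "coord_bracket F (coord_var a i j) (coord_var b k l) = F a i j b k l"
  by (simp add: coord_bracket_def)

lemma coord_bracket_const_left [simp]: "coord_bracket F (coord_const c) p = 0"
  by (simp add: coord_bracket_def)

lemma coord_bracket_const_right [simp]: "coord_bracket F p (coord_const c) = 0"
  by (simp add: coord_bracket_def deriv_ext_fun_zero)

lemma biderivation_coord_bracket:
  fixes F :: "'a \<Rightarrow> 'n \<Rightarrow> 'n \<Rightarrow> 'a \<Rightarrow> 'n \<Rightarrow> 'n \<Rightarrow> ('a, 'n, 'k::field) coord_poly"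
  shows "biderivation (coord_bracket F)"
proof
  fix x y z :: "('a, 'n, 'k) coord_poly"
  show "coord_bracket F x (y + z) = coord_bracket F x y + coord_bracket F x z"
    using deriv_ext_fun_linear[of 1 "\<lambda>a i j. deriv_ext (F a i j) y" 1 "\<lambda>a i j. deriv_ext (F a i j) z" x]
    by (simp add: coord_bracket_def deriv_ext_add)
qed (simp_all add: coord_bracket_def deriv_ext_add deriv_ext_mult deriv_ext_fun_linear)

section \<open>Linear extension from a basis\<close>

lemma lookup_free_scale [simp]: "Poly_Mapping.lookup (free_scale c x) b = c * Poly_Mapping.lookup x b"
  by (simp add: free_scale_def Poly_Mapping.map.rep_eq when_def)

lemma module_free_scale: "Modules.module (free_scale :: 'k::field \<Rightarrow> ('b \<Rightarrow>\<^sub>0 'k) \<Rightarrow> ('b \<Rightarrow>\<^sub>0 'k))"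
proof
  fix c d :: 'k and x y :: "'b \<Rightarrow>\<^sub>0 'k"
  show "free_scale c (x + y) = free_scale c x + free_scale c y"
    by (rule poly_mapping_eqI) (simp only: lookup_free_scale lookup_add distrib_left)
  show "free_scale (c + d) x = free_scale c x + free_scale d x"
    by (rule poly_mapping_eqI) (simp only: lookup_free_scale lookup_add distrib_right)
  show "free_scale c (free_scale d x) = free_scale (c * d) x"
    by (rule poly_mapping_eqI) (simp only: lookup_free_scale mult.assoc)
  show "free_scale 1 x = x"
    by (rule poly_mapping_eqI) (simp only: lookup_free_scale mult_1_left)
qed

global_interpretation free: Modules.module "free_scale :: 'k::field \<Rightarrow> ('b \<Rightarrow>\<^sub>0 'k) \<Rightarrow> ('b \<Rightarrow>\<^sub>0 'k)"
  by (rule module_free_scale)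

lemma free_scale_coord: "free_scale c p = coord_const c * p"
  by (simp add: free_scale_def coord_const_def mult_map_scale_conv_mult)

lemma linear_ext_superset:
  assumes "finite S" "Poly_Mapping.keys x \<subseteq> S"
  shows "linear_ext f x = (\<Sum>b\<in>S. free_scale (Poly_Mapping.lookup x b) (f b))"
  unfolding linear_ext_def using assms
  by (intro sum.mono_neutral_left) (auto simp: in_keys_iff)

lemma linear_ext_zero [simp]: "linear_ext f 0 = 0"
  by (simp add: linear_ext_def)

lemma linear_ext_add: "linear_ext f (x + y) = linear_ext f x + linear_ext f y"
  by (simp add: linear_ext_superset[of "Poly_Mapping.keys x \<union> Poly_Mapping.keys y"]
      Poly_Mapping.keys_add lookup_add free.scale_left_distrib sum.distrib)

lemma linear_ext_uminus: "linear_ext f (- x) = - linear_ext f x"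
  using linear_ext_add[of f x "- x"] by (simp add: minus_unique)

lemma linear_ext_diff: "linear_ext f (x - y) = linear_ext f x - linear_ext f y"
  using linear_ext_add[of f x "- y"] by (simp add: linear_ext_uminus)

lemma linear_ext_basis [simp]: "linear_ext f (basis_vec b) = f b"
  by (simp add: linear_ext_def basis_vec_def)

lemma single_conv_basis: "Poly_Mapping.single b c = free_scale c (basis_vec b)"
  by (rule poly_mapping_eqI) (simp add: basis_vec_def lookup_single when_def)

lemma linear_ext_scale: "linear_ext f (free_scale c x) = free_scale c (linear_ext f x)"
proof -
  have "Poly_Mapping.keys (free_scale c x) \<subseteq> Poly_Mapping.keys x"
    by (auto simp: in_keys_iff)
  then show ?thesis
    by (simp add: linear_ext_superset[of "Poly_Mapping.keys x"] free.scale_sum_right)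
qed

lemma free_induct [case_names zero add scale basis]:
  fixes x :: "'b \<Rightarrow>\<^sub>0 'k::field"
  assumes "P 0" and "\<And>x y. P x \<Longrightarrow> P y \<Longrightarrow> P (x + y)"
    and "\<And>c x. P x \<Longrightarrow> P (free_scale c x)" and "\<And>b. P (basis_vec b)"
  shows "P x"
  by (induction x rule: poly_mapping_single_induct) (simp_all add: assms single_conv_basis)

lemma linear_ext_comp: "linear_ext f (linear_ext g x) = linear_ext (\<lambda>b. linear_ext f (g b)) x"
  by (induction x rule: free_induct) (simp_all add: linear_ext_add linear_ext_scale)

lemma linear_ext_span_mem:
  assumes "Modules.module.subspace free_scale K" and "\<And>s. s \<in> S \<Longrightarrow> linear_ext f s \<in> K"
    and "x \<in> Modules.module.span free_scale S"
  shows "linear_ext f x \<in> K"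
proof -
  have "Modules.module.span free_scale S \<subseteq> {x. linear_ext f x \<in> K}"
    using assms(2) by (intro free.span_minimal)
      (auto intro!: free.subspaceI simp: linear_ext_add linear_ext_scale
        free.subspace_0[OF assms(1)] free.subspace_add[OF assms(1)] free.subspace_scale[OF assms(1)])
  with assms(3) show ?thesis by blast
qed

lemma ideal_subspace:
  fixes I :: "('a, 'n, 'k::field) coord_poly set"
  assumes "is_ideal I"
  shows "Modules.module.subspace free_scale I"
  by (rule free.subspaceI)
    (auto simp: free_scale_coord regular.subspace_0 regular.subspace_add regular.subspace_scale assms)

section \<open>The coordinate ring as a quotient of the polynomial ring\<close>

lemma ring_of_type_algebra_simps [simp]:
  "carrier ring_of_type_algebra = UNIV"
  "x \<oplus>\<^bsub>ring_of_type_algebra\<^esub> y = x + y" "x \<otimes>\<^bsub>ring_of_type_algebra\<^esub> y = x * y"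
  "\<one>\<^bsub>ring_of_type_algebra\<^esub> = 1" "\<zero>\<^bsub>ring_of_type_algebra\<^esub> = 0"
  by (simp_all add: ring_of_type_algebra_def)

lemma ideal_ring_of_type_algebra_iff:
  "ideal K (ring_of_type_algebra :: 'r::comm_ring_1 ring) \<longleftrightarrow> is_ideal K"
proof
  assume K: "ideal K (ring_of_type_algebra :: 'r ring)"
  then have "additive_subgroup K (ring_of_type_algebra :: 'r ring)"
    by (rule ideal.axioms)
  then show "is_ideal K"
    using additive_subgroup.zero_closed[of K "ring_of_type_algebra :: 'r ring"]
      additive_subgroup.a_closed[of K "ring_of_type_algebra :: 'r ring"]
      ideal.I_l_closed[OF K]
    by (intro regular.subspaceI) auto
next
  assume K: "is_ideal K"
  show "ideal K (ring_of_type_algebra :: 'r ring)"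
  proof (rule idealI)
    show "ring (ring_of_type_algebra :: 'r ring)"
      by (rule ring_from_type_algebra)
    interpret ring "ring_of_type_algebra :: 'r ring"
      by (rule ring_from_type_algebra)
    have "\<ominus>\<^bsub>ring_of_type_algebra\<^esub> x = - x" for x :: 'r
      by (rule minus_equality) auto
    then show "subgroup K (add_monoid (ring_of_type_algebra :: 'r ring))"
      using regular.subspace_0[OF K] regular.subspace_add[OF K] regular.subspace_neg[OF K]
      by (intro add.subgroupI) (auto simp: a_inv_def)
  qed (use regular.subspace_scale[OF K] in \<open>auto simp: mult.commute\<close>)
qed

lemma genideal_ring_of_type_algebra:
  "genideal ring_of_type_algebra S = ideal_hull S"
  by (simp add: genideal_def regular.span_def hull_def ideal_ring_of_type_algebra_iff)

lemma is_ideal_coord_ideal: "is_ideal (coord_ideal scal)"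
  by (simp add: coord_ideal_def genideal_ring_of_type_algebra)

lemma coord_ideal_add: "cong_mod (coord_ideal scal) (coord_var (a + b) i j) (coord_var a i j + coord_var b i j)"
  unfolding cong_mod_def coord_ideal_def genideal_ring_of_type_algebra
  by (rule regular.span_base) blast

lemma coord_ideal_scale: "cong_mod (coord_ideal scal) (coord_var (scal c a) i j) (coord_const c * coord_var a i j)"
  unfolding cong_mod_def coord_ideal_def genideal_ring_of_type_algebra
  by (rule regular.span_base) blast

lemma coord_ideal_mult:
  "cong_mod (coord_ideal scal) (coord_var (a * b) i j) (\<Sum>r\<in>UNIV. coord_var a i r * coord_var b r j)"
  unfolding cong_mod_def coord_ideal_def genideal_ring_of_type_algebra
  by (rule regular.span_base) blast

lemma coord_ideal_one: "cong_mod (coord_ideal scal) (coord_var 1 i j) (if i = j then 1 else 0)"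
  unfolding cong_mod_def coord_ideal_def genideal_ring_of_type_algebra
  by (rule regular.span_base) blast

text \<open>The universal property of the coordinate ring, for quotients of \<open>P\<close>.\<close>

lemma coord_ideal_minimal:
  fixes K :: "('a::{ring, monoid_mult}, 'n::finite, 'k::field) coord_poly set"
  assumes K: "is_ideal K"
    and "\<And>a b i j. cong_mod K (coord_var (a + b) i j) (coord_var a i j + coord_var b i j)"
    and "\<And>c a i j. cong_mod K (coord_var (scal c a) i j) (coord_const c * coord_var a i j)"
    and "\<And>a b i j. cong_mod K (coord_var (a * b) i j) (\<Sum>r\<in>UNIV. coord_var a i r * coord_var b r j)"
    and "\<And>i j. cong_mod K (coord_var 1 i j) (if i = j then 1 else 0)"
  shows "coord_ideal scal \<subseteq> K"
  unfolding coord_ideal_def genideal_ring_of_type_algebra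
  by (intro regular.span_minimal[OF _ K]) (use assms(2-)[unfolded cong_mod_def] in blast)

section \<open>Evaluating tensors\<close>

lemma linear_ext_cong_mod:
  fixes f g :: "'b \<Rightarrow> ('a, 'n, 'k::field) coord_poly"
  assumes I: "is_ideal I" and "\<And>b. cong_mod I (f b) (g b)"
  shows "cong_mod I (linear_ext f x) (linear_ext g x)"
  unfolding linear_ext_def free_scale_coord
  by (intro cong_mod_sum cong_mod_mult assms cong_mod_refl)

lemma linear_ext_add_fun: "linear_ext (\<lambda>b. f b + g b) x = linear_ext f x + linear_ext g x"
  by (simp add: linear_ext_def free.scale_right_distrib sum.distrib)

lemma linear_ext_sum_fun: "linear_ext (\<lambda>b. \<Sum>s\<in>S. f s b) x = (\<Sum>s\<in>S. linear_ext (f s) x)"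
  by (induction S rule: infinite_finite_induct) (simp_all add: linear_ext_add_fun, simp_all add: linear_ext_def)

lemma linear_ext_mult_left:
  fixes f :: "'b \<Rightarrow> ('a, 'n, 'k::field) coord_poly"
  shows "linear_ext (\<lambda>b. p * f b) x = p * linear_ext f x"
  by (simp add: linear_ext_def free_scale_coord sum_distrib_left mult.left_commute)

lemma linear_ext_mult_right:
  fixes f :: "'b \<Rightarrow> ('a, 'n, 'k::field) coord_poly"
  shows "linear_ext (\<lambda>b. f b * p) x = linear_ext f x * p"
  by (simp add: linear_ext_def free_scale_coord sum_distrib_right mult.assoc)

text \<open>The tensor powers are quotients whose elements are cosets; the next lemmas translate equations
  between cosets into membership of a difference.\<close>

lemma coset_eq_iff:
  assumes N: "free.subspace N"
  shows "x +o N = y +o N \<longleftrightarrow> x - y \<in> N"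
proof
  assume "x +o N = y +o N"
  moreover have "x \<in> x +o N"
    using set_plus_intro2[of 0 N x] free.subspace_0[OF N] by simp
  ultimately show "x - y \<in> N"
    by (simp add: set_minus_plus)
next
  assume *: "x - y \<in> N"
  have "u +o N \<subseteq> v +o N" if "u - v \<in> N" for u v
  proof
    fix w assume "w \<in> u +o N"
    then have "w - u \<in> N" by (simp add: set_minus_plus)
    with that have "(w - u) + (u - v) \<in> N" by (rule free.subspace_add[OF N, rotated])
    then show "w \<in> v +o N" by (simp add: set_minus_plus)
  qed
  from this[OF *] this[of y x] free.subspace_neg[OF N *] show "x +o N = y +o N" by auto
qed

lemma coset_rep_diff:
  assumes N: "free.subspace N"
  shows "coset_rep (x +o N) - x \<in> N"
proof -
  have "x \<in> x +o N"
    using set_plus_intro2[of 0 N x] free.subspace_0[OF N] by simp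
  then have "coset_rep (x +o N) \<in> x +o N"
    unfolding coset_rep_def by (rule someI)
  then show ?thesis by (simp add: set_minus_plus)
qed

lemma coset_rep_coset:
  assumes N: "free.subspace N" and "t \<in> quot_space N"
  shows "coset_rep t +o N = t"
  using assms coset_eq_iff[OF N] coset_rep_diff[OF N] by (auto simp: quot_space_def)

lemma coset_add:
  assumes N: "free.subspace N"
  shows "(x +o N) + (y +o N) = (x + y) +o N"
proof -
  have "N + N = N"
    using free.subspace_add[OF N] set_zero_plus2[OF free.subspace_0[OF N], of N]
    by (auto elim!: set_plus_elim)
  then show ?thesis by (simp add: set_plus_rearrange)
qed

definition bilinear_mod ::
    "('k::field \<Rightarrow> 'a::ab_group_add \<Rightarrow> 'a) \<Rightarrow> ('v, 'n, 'k) coord_poly set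
     \<Rightarrow> ('a \<Rightarrow> 'a \<Rightarrow> ('v, 'n, 'k) coord_poly) \<Rightarrow> bool" where
  "bilinear_mod scal I h \<longleftrightarrow>
     (\<forall>a a' b. cong_mod I (h (a + a') b) (h a b + h a' b)) \<and>
     (\<forall>a b b'. cong_mod I (h a (b + b')) (h a b + h a b')) \<and>
     (\<forall>c a b. cong_mod I (h (scal c a) b) (coord_const c * h a b)) \<and>
     (\<forall>c a b. cong_mod I (h a (scal c b)) (coord_const c * h a b))"

lemma bilinear_mod_mult:
  assumes I: "is_ideal I"
    and f: "\<And>a b. cong_mod I (f (a + b)) (f a + f b)" "\<And>c a. cong_mod I (f (scal c a)) (coord_const c * f a)"
    and g: "\<And>a b. cong_mod I (g (a + b)) (g a + g b)" "\<And>c a. cong_mod I (g (scal c a)) (coord_const c * g a)"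
  shows "bilinear_mod scal I (\<lambda>a b. f a * g b)"
  unfolding bilinear_mod_def
proof (intro conjI allI)
  fix a a' b c
  show "cong_mod I (f (a + a') * g b) (f a * g b + f a' * g b)"
    using cong_mod_mult[OF I f(1) cong_mod_refl[OF I]] by (simp add: distrib_right)
  show "cong_mod I (f (scal c a) * g b) (coord_const c * (f a * g b))"
    using cong_mod_mult[OF I f(2) cong_mod_refl[OF I]] by (simp add: mult.assoc)
  show "cong_mod I (f b * g (a + a')) (f b * g a + f b * g a')"
    using cong_mod_mult[OF I cong_mod_refl[OF I] g(1)] by (simp add: distrib_left)
  show "cong_mod I (f a * g (scal c b)) (coord_const c * (f a * g b))"
    using cong_mod_mult[OF I cong_mod_refl[OF I, of "f a"] g(2)[of c b]] by (simp only: mult.left_commute)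
qed

text \<open>A map that is bilinear modulo an ideal factors through the tensor square modulo that ideal.\<close>

lemma linear_ext_null2:
  assumes I: "is_ideal I" and h: "bilinear_mod scal I h" and x: "x \<in> null2 scal"
  shows "linear_ext (case_prod h) x \<in> I"
  using ideal_subspace[OF I] _ x[unfolded null2_def]
proof (rule linear_ext_span_mem)
  fix s
  assume "s \<in> {basis_vec (a + a', b) - basis_vec (a, b) - basis_vec (a', b) | a a' b. True} \<union>
     {basis_vec (a, b + b') - basis_vec (a, b) - basis_vec (a, b') | a b b'. True} \<union>
     {basis_vec (scal c a, b) - free_scale c (basis_vec (a, b)) | c a b. True} \<union>
     {basis_vec (a, scal c b) - free_scale c (basis_vec (a, b)) | c a b. True}"
  then show "linear_ext (case_prod h) s \<in> I"
    using h unfolding bilinear_mod_def cong_mod_def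
    by (elim UnE CollectE exE conjE)
      (simp_all add: linear_ext_diff linear_ext_add linear_ext_scale free_scale_coord diff_diff_eq)
qed

lemma subspace_null2: "free.subspace (null2 scal)"
  by (simp add: null2_def)

lemma subspace_null3: "free.subspace (null3 scal)"
  by (simp add: null3_def)

lemma linear_ext_tensor_cong:
  assumes I: "is_ideal I" and h: "bilinear_mod scal I h" and "x +o null2 scal = y +o null2 scal"
  shows "cong_mod I (linear_ext (case_prod h) x) (linear_ext (case_prod h) y)"
  using linear_ext_null2[OF I h, of "x - y"] assms(3)
  by (simp add: coset_eq_iff[OF subspace_null2] cong_mod_def linear_ext_diff)

text \<open>The evaluations \<open>x \<otimes> y \<mapsto> x\<^bsub>ij\<^esub> y\<^bsub>kl\<^esub>\<close> and \<open>x \<otimes> y \<otimes> z \<mapsto> x\<^bsub>ij\<^esub> y\<^bsub>kl\<^esub> z\<^bsub>mn\<^esub>\<close> are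
  defined on representatives, and are well defined on tensors modulo \<open>coord_ideal\<close>.\<close>

definition ev2 ::
    "'n \<Rightarrow> 'n \<Rightarrow> 'n \<Rightarrow> 'n \<Rightarrow> ('a \<times> 'a \<Rightarrow>\<^sub>0 'k::field) \<Rightarrow> ('a, 'n, 'k) coord_poly" where
  "ev2 i j k l = linear_ext (\<lambda>(x', x''). coord_var x' i j * coord_var x'' k l)"

definition ev3 ::
    "'n \<Rightarrow> 'n \<Rightarrow> 'n \<Rightarrow> 'n \<Rightarrow> 'n \<Rightarrow> 'n \<Rightarrow> ('a \<times> 'a \<times> 'a \<Rightarrow>\<^sub>0 'k::field) \<Rightarrow> ('a, 'n, 'k) coord_poly" where
  "ev3 i j k l m n =
     linear_ext (\<lambda>(x', x'', x'''). coord_var x' i j * coord_var x'' k l * coord_var x''' m n)"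

lemma sweedler_poly_ev2: "sweedler_poly t i j k l = ev2 i j k l (coset_rep t)"
  by (simp add: sweedler_poly_def ev2_def)

lemma bilinear_coord_var: "bilinear_mod scal (coord_ideal scal) (\<lambda>a b. coord_var a i j * coord_var b k l)"
  by (intro bilinear_mod_mult is_ideal_coord_ideal coord_ideal_add coord_ideal_scale)

lemma ev2_cong:
  assumes "x +o null2 scal = y +o null2 scal"
  shows "cong_mod (coord_ideal scal) (ev2 i j k l x) (ev2 i j k l y)"
  unfolding ev2_def by (rule linear_ext_tensor_cong[OF is_ideal_coord_ideal bilinear_coord_var assms])

lemma sweedler_poly_coset:
  "cong_mod (coord_ideal scal) (sweedler_poly (x +o null2 scal) i j k l) (ev2 i j k l x)"
  unfolding sweedler_poly_ev2
  by (rule ev2_cong) (simp add: coset_eq_iff coset_rep_diff subspace_null2)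

lemma ev3_null3:
  fixes i j k l m n :: "'n::finite" and scal :: "'k::field \<Rightarrow> 'a::{ring, monoid_mult} \<Rightarrow> 'a"
  assumes "x \<in> null3 scal"
  shows "ev3 i j k l m n x \<in> coord_ideal scal"
  unfolding ev3_def using ideal_subspace[OF is_ideal_coord_ideal] _ assms[unfolded null3_def]
proof (rule linear_ext_span_mem)
  note I = is_ideal_coord_ideal[of scal]
  note [simp] = linear_ext_diff linear_ext_add linear_ext_scale free_scale_coord diff_diff_eq
  have *: "x - y \<in> coord_ideal scal" if "cong_mod (coord_ideal scal) x' y'" "x = x' * z" "y = y' * z"
    for x y x' y' z :: "('a, 'n, 'k) coord_poly"
    using cong_mod_mult[OF I that(1) cong_mod_refl[OF I, of z]] that(2,3) by (simp add: cong_mod_def)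
  fix s
  assume "s \<in> {basis_vec (x + x', y, z) - basis_vec (x, y, z) - basis_vec (x', y, z) | x x' y z. True} \<union>
     {basis_vec (x, y + y', z) - basis_vec (x, y, z) - basis_vec (x, y', z) | x y y' z. True} \<union>
     {basis_vec (x, y, z + z') - basis_vec (x, y, z) - basis_vec (x, y, z') | x y z z'. True} \<union>
     {basis_vec (scal c x, y, z) - free_scale c (basis_vec (x, y, z)) | c x y z. True} \<union>
     {basis_vec (x, scal c y, z) - free_scale c (basis_vec (x, y, z)) | c x y z. True} \<union>
     {basis_vec (x, y, scal c z) - free_scale c (basis_vec (x, y, z)) | c x y z. True}"
  then show "linear_ext (\<lambda>(x', x'', x'''). coord_var x' i j * coord_var x'' k l * coord_var x''' m n) s
      \<in> coord_ideal scal"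
  proof (elim UnE CollectE exE conjE, goal_cases)
    case (1 x x' y z)
    show ?case unfolding 1(1)
      by simp (rule *[OF coord_ideal_add[of scal x x' i j], of _ "coord_var y k l * coord_var z m n"],
        simp_all add: mult.assoc distrib_right)
  next
    case (2 x y y' z)
    show ?case unfolding 2(1)
      by simp (rule *[OF coord_ideal_add[of scal y y' k l], of _ "coord_var x i j * coord_var z m n"],
        simp_all only: mult.assoc mult.left_commute mult.commute distrib_right distrib_left)
  next
    case (3 x y z z')
    show ?case unfolding 3(1)
      by simp (rule *[OF coord_ideal_add[of scal z z' m n], of _ "coord_var x i j * coord_var y k l"],
        simp_all only: mult.assoc mult.left_commute mult.commute distrib_right distrib_left)
  next
    case (4 c x y z)
    show ?case unfolding 4(1)
      by simp (rule *[OF coord_ideal_scale[of scal c x i j], of _ "coord_var y k l * coord_var z m n"],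
        simp_all add: mult.assoc)
  next
    case (5 c x y z)
    show ?case unfolding 5(1)
      by simp (rule *[OF coord_ideal_scale[of scal c y k l], of _ "coord_var x i j * coord_var z m n"],
        simp_all only: mult.assoc mult.left_commute mult.commute)
  next
    case (6 c x y z)
    show ?case unfolding 6(1)
      by simp (rule *[OF coord_ideal_scale[of scal c z m n], of _ "coord_var x i j * coord_var y k l"],
        simp_all only: mult.assoc mult.left_commute mult.commute)
  qed
qed

lemma ev3_cong:
  fixes i j k l m n :: "'n::finite" and scal :: "'k::field \<Rightarrow> 'a::{ring, monoid_mult} \<Rightarrow> 'a"
  assumes "x +o null3 scal = y +o null3 scal"
  shows "cong_mod (coord_ideal scal) (ev3 i j k l m n x) (ev3 i j k l m n y)"
  using assms ev3_null3[of "x - y" scal]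
  by (simp add: coset_eq_iff[OF subspace_null3] cong_mod_def ev3_def linear_ext_diff)

lemma ev3_coset:
  "cong_mod (coord_ideal scal) (ev3 i j k l m n (coset_rep (x +o null3 scal))) (ev3 i j k l m n x)"
  by (rule ev3_cong) (simp add: coset_eq_iff coset_rep_diff subspace_null3)

text \<open>As the product in \<open>P\<close> is commutative, rotating the tensor factors amounts to rotating the three pairs
  of indices.\<close>

lemma ev3_rot3:
  fixes i j k l m n :: "'n::finite" and scal :: "'k::field \<Rightarrow> 'a::{ring, monoid_mult} \<Rightarrow> 'a"
  shows "cong_mod (coord_ideal scal) (ev3 i j k l m n (coset_rep (rot3 scal t))) (ev3 k l m n i j (coset_rep t))"
proof -
  have "ev3 i j k l m n (linear_ext (\<lambda>(x', x'', x'''). basis_vec (x''', x', x'')) x) = ev3 k l m n i j x"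
    for x :: "'a \<times> 'a \<times> 'a \<Rightarrow>\<^sub>0 'k"
    unfolding ev3_def linear_ext_comp
    by (rule arg_cong[where f = "\<lambda>f. linear_ext f x"])
      (auto simp: fun_eq_iff mult.assoc mult.left_commute mult.commute)
  with ev3_coset[of scal i j k l m n "linear_ext (\<lambda>(x', x'', x'''). basis_vec (x''', x', x'')) (coset_rep t)"]
  show ?thesis
    by (simp add: rot3_def quot_map_def)
qed

section \<open>Van den Bergh's Poisson bracket of the coordinate ring\<close>

text \<open>The defects of antisymmetry and of the Jacobi identity for a biderivation. The first is a
  biderivation, the second is a triderivation up to multiples of the first; both thus vanish modulo an
  ideal if they do so on generators.\<close>

context biderivation
begin

definition jacobiator :: "'r \<Rightarrow> 'r \<Rightarrow> 'r \<Rightarrow> 'r" where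
  "jacobiator p q r = B p (B q r) + B q (B r p) + B r (B p q)"

lemma symmetrized_mult: "B (p * p') q + B q (p * p') = p * (B p' q + B q p') + p' * (B p q + B q p)"
  by (simp add: mult_left mult_right algebra_simps)

lemma jacobiator_rotate: "jacobiator p q r = jacobiator q r p"
  by (simp add: jacobiator_def algebra_simps)

lemma jacobiator_add: "jacobiator (p + p') q r = jacobiator p q r + jacobiator p' q r"
  by (simp add: jacobiator_def add_left add_right algebra_simps)

lemma jacobiator_mult:
  "jacobiator (p * p') q r = p * jacobiator p' q r + p' * jacobiator p q r
     + (B p q + B q p) * B r p' + (B p' q + B q p') * B r p"
  by (simp add: jacobiator_def mult_left mult_right add_left add_right algebra_simps)

end

locale double_poisson_algebra = k_algebra scal
  for scal :: "'k::field \<Rightarrow> 'a::{ring, monoid_mult} \<Rightarrow> 'a" +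
  fixes db :: "'a \<Rightarrow> 'a \<Rightarrow> ('a \<times> 'a \<Rightarrow>\<^sub>0 'k) set"
  assumes double_poisson: "double_poisson_bracket scal db"
begin

abbreviation I :: "('a, 'n::finite, 'k) coord_poly set" where
  "I \<equiv> coord_ideal scal"

abbreviation db_rep :: "'a \<Rightarrow> 'a \<Rightarrow> ('a \<times> 'a \<Rightarrow>\<^sub>0 'k)" where
  "db_rep a b \<equiv> coset_rep (db a b)"

lemmas I_ideal = is_ideal_coord_ideal[of scal]
lemmas I_refl = cong_mod_refl[OF I_ideal]
  and I_sym = cong_mod_sym[OF I_ideal] and I_trans [trans] = cong_mod_trans[OF I_ideal]
  and I_add = cong_mod_add[OF I_ideal]
  and I_mult = cong_mod_mult[OF I_ideal] and I_diff = cong_mod_diff[OF I_ideal]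
  and I_sum = cong_mod_sum[OF I_ideal]

lemmas double_bracket_axioms =
  double_poisson[unfolded double_poisson_bracket_def double_bracket_def, THEN conjunct1]
lemmas double_jacobi =
  double_poisson[unfolded double_poisson_bracket_def, THEN conjunct2, rule_format]

lemmas db_tensor2 = double_bracket_axioms[THEN conjunct1, rule_format]
  and db_add_right = double_bracket_axioms[THEN conjunct2, THEN conjunct2, THEN conjunct1, rule_format]
  and db_scale_right = double_bracket_axioms[THEN conjunct2, THEN conjunct2, THEN conjunct2,
    THEN conjunct2, THEN conjunct1, rule_format]
  and db_antisym = double_bracket_axioms[THEN conjunct2, THEN conjunct2, THEN conjunct2,
    THEN conjunct2, THEN conjunct2, THEN conjunct1, rule_format]
  and db_leibniz = double_bracket_axioms[THEN conjunct2, THEN conjunct2, THEN conjunct2,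
    THEN conjunct2, THEN conjunct2, THEN conjunct2, rule_format]

lemma db_coset: "db_rep a b +o null2 scal = db a b"
  by (rule coset_rep_coset[OF subspace_null2 db_tensor2])

lemma sweedler_db:
  assumes "db a b = x +o null2 scal"
  shows "cong_mod I (sweedler_poly (db a b) i j k l) (ev2 i j k l x)"
  unfolding assms by (rule sweedler_poly_coset)

lemma ev2_add: "ev2 i j k l (x + y) = ev2 i j k l x + ev2 i j k l y"
  by (simp add: ev2_def linear_ext_add)

lemma ev2_scale: "ev2 i j k l (free_scale c x) = coord_const c * ev2 i j k l x"
  by (simp add: ev2_def linear_ext_scale free_scale_coord)

lemma sweedler_add_right:
  "cong_mod I (sweedler_poly (db a (b + b')) i j k l)
     (sweedler_poly (db a b) i j k l + sweedler_poly (db a b') i j k l)"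
proof -
  have "db a (b + b') = db a b + db a b'"
    by (rule db_add_right)
  also have "\<dots> = (db_rep a b + db_rep a b') +o null2 scal"
    by (simp add: db_coset flip: coset_add[OF subspace_null2])
  finally show ?thesis
    using sweedler_db by (fastforce simp: ev2_add sweedler_poly_ev2)
qed

lemma sweedler_scale_right:
  "cong_mod I (sweedler_poly (db a (scal c b)) i j k l) (coord_const c * sweedler_poly (db a b) i j k l)"
proof -
  have "db a (scal c b) = free_scale c (db_rep a b) +o null2 scal"
    by (simp add: db_scale_right quot_scale_def)
  then show ?thesis
    using sweedler_db by (fastforce simp: ev2_scale sweedler_poly_ev2)
qed

lemma db_flip:
  "db a b = free_scale (- 1) (linear_ext (\<lambda>(x', x''). basis_vec (x'', x')) (db_rep b a)) +o null2 scal"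
proof -
  let ?x = "linear_ext (\<lambda>(x', x''). basis_vec (x'', x')) (db_rep b a)"
  have "db a b = quot_scale (null2 scal) (- 1) (flip2 scal (db b a))"
    by (rule db_antisym)
  also have "\<dots> = free_scale (- 1) (coset_rep (?x +o null2 scal)) +o null2 scal"
    by (simp add: quot_scale_def flip2_def quot_map_def)
  also have "\<dots> = free_scale (- 1) ?x +o null2 scal"
    unfolding coset_eq_iff[OF subspace_null2] free.scale_right_diff_distrib[symmetric]
    by (rule free.subspace_scale[OF subspace_null2 coset_rep_diff[OF subspace_null2]])
  finally show ?thesis .
qed

text \<open>The antisymmetry of the double bracket, in the form in which it applies to every bilinear evaluation
  and not only to \<open>sweedler_poly\<close>.\<close>

lemma linear_ext_db_flip:
  assumes "bilinear_mod scal I h"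
  shows "cong_mod I (linear_ext (case_prod h) (db_rep a b)) (- linear_ext (\<lambda>(x', x''). h x'' x') (db_rep b a))"
proof -
  have "cong_mod I (linear_ext (case_prod h) (db_rep a b)) (linear_ext (case_prod h)
      (free_scale (- 1) (linear_ext (\<lambda>(x', x''). basis_vec (x'', x')) (db_rep b a))))"
    by (rule linear_ext_tensor_cong[OF I_ideal assms]) (subst db_coset, rule db_flip)
  also have "linear_ext (case_prod h)
      (free_scale (- 1) (linear_ext (\<lambda>(x', x''). basis_vec (x'', x')) (db_rep b a)))
      = - linear_ext (\<lambda>(x', x''). h x'' x') (db_rep b a)"
    by (simp add: linear_ext_uminus linear_ext_comp case_prod_unfold)
  finally show ?thesis .
qed

lemma sweedler_antisym:
  "cong_mod I (sweedler_poly (db a b) i j k l) (- sweedler_poly (db b a) k l i j)"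
  using linear_ext_db_flip[OF bilinear_coord_var[of scal i j k l], of a b]
  by (simp add: sweedler_poly_ev2 ev2_def mult.commute)

lemma sweedler_leibniz:
  "cong_mod I (sweedler_poly (db a (b * c)) i j k l)
     ((\<Sum>r\<in>UNIV. sweedler_poly (db a b) i j k r * coord_var c r l) +
      (\<Sum>r\<in>UNIV. coord_var b i r * sweedler_poly (db a c) r j k l))"
proof -
  let ?x = "linear_ext (\<lambda>(x', x''). basis_vec (x', x'' * c)) (db_rep a b)"
  let ?y = "linear_ext (\<lambda>(x', x''). basis_vec (b * x', x'')) (db_rep a c)"
  have "db a (b * c) = rmult2 scal (db a b) c + lmult2 scal b (db a c)"
    by (rule db_leibniz)
  also have "\<dots> = (?x + ?y) +o null2 scal"
    by (simp add: rmult2_def lmult2_def quot_map_def flip: coset_add[OF subspace_null2])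
  finally have "cong_mod I (sweedler_poly (db a (b * c)) i j k l) (ev2 i j k l ?x + ev2 i j k l ?y)"
    using sweedler_db by (fastforce simp: ev2_add)
  also have "cong_mod I (ev2 i j k l ?x + ev2 i j k l ?y)
      (linear_ext (\<lambda>(x', x''). coord_var x' i j * (\<Sum>r\<in>UNIV. coord_var x'' k r * coord_var c r l)) (db_rep a b)
     + linear_ext (\<lambda>(x', x''). (\<Sum>r\<in>UNIV. coord_var b i r * coord_var x' r j) * coord_var x'' k l) (db_rep a c))"
    unfolding ev2_def linear_ext_comp
    by (intro I_add linear_ext_cong_mod I_ideal)
      (auto simp: split_beta intro!: I_mult I_refl coord_ideal_mult)
  also have "\<dots> = (\<Sum>r\<in>UNIV. sweedler_poly (db a b) i j k r * coord_var c r l) +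
      (\<Sum>r\<in>UNIV. coord_var b i r * sweedler_poly (db a c) r j k l)"
    by (simp add: sweedler_poly_ev2 ev2_def case_prod_unfold sum_distrib_left sum_distrib_right linear_ext_sum_fun
        mult.assoc linear_ext_mult_left flip: linear_ext_mult_right)
  finally show ?thesis .
qed

text \<open>By the Leibniz rule for \<open>1 * 1\<close> the evaluation is twice itself.\<close>

lemma sweedler_one: "sweedler_poly (db a 1) i j k l \<in> I"
proof -
  let ?S = "sweedler_poly (db a 1)"
  have "cong_mod I (?S i j k l)
     ((\<Sum>r\<in>UNIV. ?S i j k r * coord_var 1 r l) + (\<Sum>r\<in>UNIV. coord_var 1 i r * ?S r j k l))"
    using sweedler_leibniz[of a 1 1] by simp
  also have "cong_mod I \<dots> ((\<Sum>r\<in>UNIV. ?S i j k r * (if r = l then 1 else 0))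
      + (\<Sum>r\<in>UNIV. (if i = r then 1 else 0) * ?S r j k l))"
    by (intro I_add I_sum I_mult I_refl coord_ideal_one)
  also have "\<dots> = ?S i j k l + ?S i j k l"
    by (simp add: if_distrib[of "(*) _"] if_distribR sum.delta' if_distrib[of "\<lambda>x. x * _"] cong: if_cong)
  finally show ?thesis
    using regular.subspace_neg[OF I_ideal] by (fastforce simp: cong_mod_def)
qed

text \<open>The evaluation of \<open>\<lbrace>a, \<lbrace>b, c\<rbrace>\<rbrace>\<^sub>L\<close> at three pairs of indices.\<close>

definition nested :: "'a \<Rightarrow> 'a \<Rightarrow> 'a \<Rightarrow> 'n \<Rightarrow> 'n \<Rightarrow> 'n \<Rightarrow> 'n \<Rightarrow> 'n \<Rightarrow> 'n \<Rightarrow> ('a, 'n, 'k) coord_poly" where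
  "nested a b c i j k l m n =
     linear_ext (\<lambda>(x', x''). sweedler_poly (db a x') i j k l * coord_var x'' m n) (db_rep b c)"

lemma ev3_bracket_L:
  fixes i j k l m n :: "'n::finite"
  shows "cong_mod I (ev3 i j k l m n (coset_rep (bracket_L scal db a (db b c)))) (nested a b c i j k l m n)"
proof -
  let ?x = "linear_ext (\<lambda>(x', x''). linear_ext (\<lambda>(y', y''). basis_vec (y', y'', x'')) (db_rep a x')) (db_rep b c)"
  have "ev3 i j k l m n ?x = nested a b c i j k l m n"
    by (simp add: ev3_def nested_def linear_ext_comp case_prod_unfold sweedler_poly_ev2 ev2_def
        flip: linear_ext_mult_right)
  then show ?thesis
    using ev3_coset[of scal i j k l m n ?x] by (simp add: bracket_L_def quot_map_def)
qed

lemma nested_jacobi: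
  fixes i j k l m n :: "'n::finite"
  shows "nested a b c i j k l m n + nested b c a k l m n i j + nested c a b m n i j k l \<in> I"
proof -
  let ?t = "\<lambda>a b c. bracket_L scal db a (db b c)"
  let ?s = "rot3 scal (?t b c a)" and ?r = "rot3 scal (rot3 scal (?t c a b))"
  have quot: "coset_rep (t +o null3 scal) +o null3 scal = t +o null3 scal" for t
    by (simp add: coset_eq_iff coset_rep_diff subspace_null3)
  have eq: "?t a b c + ?s + ?r = null3 scal"
    by (rule double_jacobi)
  have "(coset_rep (?t a b c) + coset_rep ?s + coset_rep ?r) +o null3 scal
      = (coset_rep (?t a b c) +o null3 scal) + (coset_rep ?s +o null3 scal) + (coset_rep ?r +o null3 scal)"
    by (simp add: coset_add[OF subspace_null3])
  also have "\<dots> = 0 +o null3 scal"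
    using eq by (simp add: bracket_L_def rot3_def quot_map_def quot)
  finally have "cong_mod I (ev3 i j k l m n (coset_rep (?t a b c) + coset_rep ?s + coset_rep ?r)) (ev3 i j k l m n 0)"
    by (rule ev3_cong)
  then have "ev3 i j k l m n (coset_rep (?t a b c)) + ev3 i j k l m n (coset_rep ?s) + ev3 i j k l m n (coset_rep ?r) \<in> I"
    by (simp add: ev3_def linear_ext_add cong_mod_def)
  moreover have "cong_mod I (ev3 i j k l m n (coset_rep (?t a b c)) + ev3 i j k l m n (coset_rep ?s) + ev3 i j k l m n (coset_rep ?r))
      (nested a b c i j k l m n + nested b c a k l m n i j + nested c a b m n i j k l)"
    by (intro I_add) (rule ev3_bracket_L I_trans[OF ev3_rot3] I_trans[OF ev3_rot3 I_trans[OF ev3_rot3]], (rule ev3_bracket_L)?)+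
  ultimately show ?thesis
    using cong_mod_mem[OF I_ideal] by blast
qed

text \<open>Van den Bergh's formula \<open>[a\<^bsub>ij\<^esub>, b\<^bsub>kl\<^esub>] = \<lbrace>a, b\<rbrace>'\<^bsub>kj\<^esub> \<lbrace>a, b\<rbrace>''\<^bsub>il\<^esub>\<close>.\<close>

definition vdb :: "('a, 'n, 'k) coord_poly \<Rightarrow> ('a, 'n, 'k) coord_poly \<Rightarrow> ('a, 'n, 'k) coord_poly" where
  "vdb = coord_bracket (\<lambda>a i j b k l. sweedler_poly (db a b) k j i l)"

sublocale vdb: biderivation vdb
  unfolding vdb_def by (rule biderivation_coord_bracket)

lemma vdb_var [simp]: "vdb (coord_var a i j) (coord_var b k l) = sweedler_poly (db a b) k j i l"
  by (simp add: vdb_def coord_bracket_var)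

lemma vdb_const_left [simp]: "vdb (coord_const c) p = 0"
  by (simp add: vdb_def)

lemma vdb_const_right [simp]: "vdb p (coord_const c) = 0"
  by (simp add: vdb_def)

lemma vdb_linear_ext: "vdb p (linear_ext f x) = linear_ext (\<lambda>b. vdb p (f b)) x"
  by (simp add: linear_ext_def vdb.sum_right free_scale_coord vdb.mult_right)

lemma vdb_symmetrized:
  fixes p q :: "('a, 'n::finite, 'k) coord_poly"
  shows "vdb p q + vdb q p \<in> I"
proof -
  have sum: "vdb (p + p') q + vdb q (p + p') \<in> I"
    if "vdb p q + vdb q p \<in> I" "vdb p' q + vdb q p' \<in> I" for p p' q :: "('a, 'n, 'k) coord_poly"
    using regular.subspace_add[OF I_ideal that]
    by (simp add: vdb.add_left vdb.add_right add.assoc add.left_commute)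
  have prod: "vdb (p * p') q + vdb q (p * p') \<in> I"
    if "vdb p q + vdb q p \<in> I" "vdb p' q + vdb q p' \<in> I" for p p' q :: "('a, 'n, 'k) coord_poly"
    unfolding vdb.symmetrized_mult
    by (rule regular.subspace_add[OF I_ideal regular.subspace_scale[OF I_ideal that(2)]
          regular.subspace_scale[OF I_ideal that(1)]])
  show ?thesis
  proof (induction p rule: coord_poly_induct)
    case (const c)
    show ?case by (simp add: regular.subspace_0[OF I_ideal])
  next
    case (var a i j)
    show ?case
    proof (induction q rule: coord_poly_induct)
      case (const c)
      show ?case by (simp add: regular.subspace_0[OF I_ideal])
    next
      case (var b k l)
      show ?case
        using sweedler_antisym[of a b k j i l] by (simp add: cong_mod_def)
    next
      case (add p q)
      then show ?case
        using sum[of p "coord_var a i j" q] by (simp add: add.commute)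
    next
      case (mult p q)
      then show ?case
        using prod[of p "coord_var a i j" q] by (simp add: add.commute)
    qed
  qed (fact sum prod)+
qed

lemma vdb_mem_of_vars:
  fixes p :: "('a, 'n::finite, 'k) coord_poly"
  assumes "\<And>a i j. vdb (coord_var a i j) q \<in> I"
  shows "vdb p q \<in> I"
  by (induction p rule: coord_poly_induct)
    (auto simp: vdb.add_left vdb.mult_left regular.subspace_0[OF I_ideal] assms
      intro!: regular.subspace_add regular.subspace_scale I_ideal)

lemma vdb_relation:
  fixes p :: "('a, 'n::finite, 'k) coord_poly"
  assumes "\<And>a i j. cong_mod I (vdb (coord_var a i j) q) (vdb (coord_var a i j) q')"
  shows "vdb p (q - q') \<in> I"
  by (rule vdb_mem_of_vars) (use assms in \<open>simp add: vdb.diff_right cong_mod_def\<close>)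

text \<open>On a relation of the coordinate ring, bracketing with \<open>a\<^bsub>ij\<^esub>\<close> gives an instance of the linearity or of the
  Leibniz rule of the double bracket.\<close>

lemma vdb_ideal:
  fixes p :: "('a, 'n::finite, 'k) coord_poly"
  assumes "q \<in> I"
  shows "vdb p q \<in> I"
proof -
  let ?K = "{q \<in> I. vdb p q \<in> I}"
  have "I \<subseteq> ?K"
  proof (rule coord_ideal_minimal)
    show "is_ideal ?K"
      by (rule vdb.is_ideal_stabilizer[OF I_ideal])
  next
    fix a b and i j :: 'n
    show "cong_mod ?K (coord_var (a + b) i j) (coord_var a i j + coord_var b i j)"
      unfolding cong_mod_def
      by (auto intro!: vdb_relation coord_ideal_add[unfolded cong_mod_def]
          simp: vdb.add_right sweedler_add_right)
  next
    fix c a and i j :: 'n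
    show "cong_mod ?K (coord_var (scal c a) i j) (coord_const c * coord_var a i j)"
      unfolding cong_mod_def
      by (auto intro!: vdb_relation coord_ideal_scale[unfolded cong_mod_def]
          simp: vdb.mult_right sweedler_scale_right)
  next
    fix a b and i j :: 'n
    have "cong_mod I (vdb (coord_var c m n) (coord_var (a * b) i j))
       (vdb (coord_var c m n) (\<Sum>r\<in>UNIV. coord_var a i r * coord_var b r j))" for c m n
      using sweedler_leibniz[of c a b i n m j]
      by (simp add: vdb.sum_right vdb.mult_right sum.distrib add.commute mult.commute)
    then show "cong_mod ?K (coord_var (a * b) i j) (\<Sum>r\<in>UNIV. coord_var a i r * coord_var b r j)"
      unfolding cong_mod_def[of ?K]
      by (auto intro!: vdb_relation coord_ideal_mult[unfolded cong_mod_def])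
  next
    fix i j :: 'n
    have "vdb p (coord_var 1 i j - (if i = j then 1 else 0)) \<in> I"
      by (rule vdb_relation) (simp add: sweedler_one cong_mod_0_iff[OF I_ideal])
    then show "cong_mod ?K (coord_var 1 i j) (if i = j then 1 else 0)"
      using coord_ideal_one[of scal i j] unfolding cong_mod_def by blast
  qed
  then show ?thesis using assms by blast
qed

text \<open>Write \<open>[b\<^bsub>kl\<^esub>, c\<^bsub>uv\<^esub>] = x'\<^bsub>ul\<^esub> x''\<^bsub>kv\<^esub>\<close> with \<open>\<lbrace>b, c\<rbrace> = x' \<otimes> x''\<close>. When \<open>a\<^bsub>ij\<^esub>\<close> is bracketed with
  \<open>x'\<close> one obtains \<open>\<lbrace>a, \<lbrace>b, c\<rbrace>\<rbrace>\<^sub>L\<close>. When it is bracketed with \<open>x''\<close> one rewrites \<open>\<lbrace>b, c\<rbrace>\<close> as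
  \<open>- \<lbrace>c, b\<rbrace>\<close> with its factors exchanged and obtains \<open>\<lbrace>a, \<lbrace>c, b\<rbrace>\<rbrace>\<^sub>L\<close> with the opposite sign.\<close>

lemma vdb_nested:
  fixes i j k l u v :: "'n::finite"
  shows "cong_mod I (vdb (coord_var a i j) (vdb (coord_var b k l) (coord_var c u v)))
    (nested a b c u j i l k v - nested a c b k j i v u l)"
proof -
  let ?h = "\<lambda>x y. coord_var x u l * sweedler_poly (db a y) k j i v"
  have "vdb (coord_var a i j) (vdb (coord_var b k l) (coord_var c u v))
    = linear_ext (\<lambda>(x', x''). ?h x' x'' + sweedler_poly (db a x') u j i l * coord_var x'' k v) (db_rep b c)"
    by (simp add: sweedler_poly_ev2[of "db b c"] ev2_def vdb_linear_ext case_prod_unfold vdb.mult_right mult.commute)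
  also have "\<dots> = nested a b c u j i l k v + linear_ext (case_prod ?h) (db_rep b c)"
    by (simp add: nested_def case_prod_unfold linear_ext_add_fun)
  also have "cong_mod I \<dots> (nested a b c u j i l k v + - linear_ext (\<lambda>(x', x''). ?h x'' x') (db_rep c b))"
    by (intro I_add I_refl linear_ext_db_flip bilinear_mod_mult I_ideal coord_ideal_add coord_ideal_scale
        sweedler_add_right sweedler_scale_right)
  also have "\<dots> = nested a b c u j i l k v - nested a c b k j i v u l"
    by (simp add: nested_def mult.commute)
  finally show ?thesis .
qed

text \<open>The three positive and the three negative terms of \<open>vdb_nested\<close> are each a cyclic sum, to which the
  double Jacobi identity applies, for \<open>(a, b, c)\<close> and for \<open>(a, c, b)\<close>.\<close>

lemma vdb_jacobiator_var:
  fixes i j k l u v :: "'n::finite"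
  shows "vdb.jacobiator (coord_var a i j) (coord_var b k l) (coord_var c u v) \<in> I"
proof -
  have "cong_mod I (vdb.jacobiator (coord_var a i j) (coord_var b k l) (coord_var c u v))
     ((nested a b c u j i l k v - nested a c b k j i v u l) +
      (nested b c a i l k v u j - nested b a c u l k j i v) +
      (nested c a b k v u j i l - nested c b a i v u l k j))"
    unfolding vdb.jacobiator_def by (intro I_add vdb_nested)
  also have "\<dots> =
      (nested a b c u j i l k v + nested b c a i l k v u j + nested c a b k v u j i l) -
      (nested a c b k j i v u l + nested c b a i v u l k j + nested b a c u l k j i v)"
    by simp
  also have "cong_mod I \<dots> (0 - 0)"
    by (intro I_diff) (simp_all add: cong_mod_0_iff[OF I_ideal] nested_jacobi)
  finally show ?thesis by (simp add: cong_mod_0_iff[OF I_ideal])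
qed

lemma vdb_jacobiator:
  fixes p q r :: "('a, 'n::finite, 'k) coord_poly"
  shows "vdb.jacobiator p q r \<in> I"
proof -
  have extend: "vdb.jacobiator p q r \<in> I"
    if var: "\<And>a i j. vdb.jacobiator (coord_var a i j) q r \<in> I" for p q r :: "('a, 'n, 'k) coord_poly"
  proof (induction p rule: coord_poly_induct)
    case (const c)
    show ?case by (simp add: vdb.jacobiator_def regular.subspace_0[OF I_ideal])
  next
    case (mult p p')
    then show ?case
      unfolding vdb.jacobiator_mult mult.commute[of "vdb _ _ + vdb _ _"]
      by - (rule vdb_symmetrized regular.subspace_add[OF I_ideal] regular.subspace_scale[OF I_ideal] | assumption)+
  qed (use var in \<open>auto simp: vdb.jacobiator_add intro: regular.subspace_add I_ideal\<close>)
  show ?thesis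
    by (rule extend, subst vdb.jacobiator_rotate, rule extend, subst vdb.jacobiator_rotate,
        rule extend, subst vdb.jacobiator_rotate, rule vdb_jacobiator_var)
qed

lemma poisson_mod_vdb: "poisson_mod (I :: ('a, 'n::finite, 'k) coord_poly set) vdb"
proof
  fix x y z y' :: "('a, 'n, 'k) coord_poly"
  show "cong_mod I (vdb x y) (vdb x y')" if "cong_mod I y y'"
    using vdb_ideal[of "y - y'" x] that by (simp add: cong_mod_def vdb.diff_right)
  show "cong_mod I (vdb x (y * z)) (vdb x y * z + y * vdb x z)"
    by (simp add: vdb.mult_right I_refl add.commute mult.commute)
  show "cong_mod I (vdb x y) (- vdb y x)"
    using vdb_symmetrized[of x y] by (simp add: cong_mod_def)
  show "cong_mod I (vdb x (vdb y z) + vdb y (vdb z x) + vdb z (vdb x y)) 0"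
    using vdb_jacobiator[of x y z] by (simp add: vdb.jacobiator_def cong_mod_def)
qed (simp_all add: I_ideal vdb.add_right I_refl)

end

section \<open>Involutions of matrix algebras\<close>

lemma matrix_unit_mult_left: "(matrix_unit i j ** N) $ p $ q = (if p = i then N $ j $ q else 0)"
proof -
  have "(matrix_unit i j ** N) $ p $ q = (\<Sum>r\<in>UNIV. if r = j then if p = i then N $ r $ q else 0 else 0)"
    unfolding matrix_matrix_mult_def matrix_unit_def vec_lambda_beta
    by (rule sum.cong[OF refl]) simp
  then show ?thesis by (simp add: sum.delta)
qed

lemma matrix_unit_mult_right: "(N ** matrix_unit i j) $ p $ q = (if q = j then N $ p $ i else 0)"
proof -
  have "(N ** matrix_unit i j) $ p $ q = (\<Sum>r\<in>UNIV. if r = i then if q = j then N $ p $ r else 0 else 0)"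
    unfolding matrix_matrix_mult_def matrix_unit_def vec_lambda_beta
    by (rule sum.cong[OF refl]) simp
  then show ?thesis by (simp add: sum.delta)
qed

lemma matrix_unit_mult:
  "matrix_unit i j ** matrix_unit k l = (if j = k then matrix_unit i l else 0)"
  by (auto simp: vec_eq_iff matrix_unit_mult_left) (auto simp: matrix_unit_def)

lemma matrix_eq_sum_units: "M = (\<Sum>m\<in>UNIV. \<Sum>n\<in>UNIV. matrix_scale (M $ m $ n) (matrix_unit m n))"
proof -
  have "(\<Sum>m\<in>UNIV. \<Sum>n\<in>UNIV. matrix_scale (M $ m $ n) (matrix_unit m n)) $ p $ q
      = (\<Sum>m\<in>UNIV. \<Sum>n\<in>UNIV. if n = q then if m = p then M $ m $ n else 0 else 0)" for p q
    unfolding sum_component by (intro sum.cong refl) (auto simp: matrix_scale_def matrix_unit_def)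
  then have "(\<Sum>m\<in>UNIV. \<Sum>n\<in>UNIV. matrix_scale (M $ m $ n) (matrix_unit m n)) $ p $ q = M $ p $ q" for p q
    by (simp only: sum.delta finite_class.finite_UNIV) (simp add: sum.delta)
  then show ?thesis by (simp only: vec_eq_iff) simp
qed

locale matrix_involution =
  fixes \<tau> :: "'k::field_char_0 ^ 'n::finite ^ 'n \<Rightarrow> 'k ^ 'n ^ 'n"
  assumes matrix_involution: "algebra_involution matrix_scale (**) \<tau>"
begin

lemma \<tau>_scale: "\<tau> (matrix_scale c M) = matrix_scale c (\<tau> M)"
  and \<tau>_zero [simp]: "\<tau> 0 = 0"
  and \<tau>_sum: "\<tau> (sum f S) = (\<Sum>s\<in>S. \<tau> (f s))"
proof -
  interpret linear: Vector_Spaces.linear matrix_scale matrix_scale \<tau>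
    using matrix_involution by (simp add: algebra_involution_def)
  show "\<tau> (matrix_scale c M) = matrix_scale c (\<tau> M)" "\<tau> 0 = 0" "\<tau> (sum f S) = (\<Sum>s\<in>S. \<tau> (f s))"
    by (fact linear.scale linear.zero linear.sum)+
qed

lemma \<tau>_anti: "\<tau> (M ** N) = \<tau> N ** \<tau> M"
  and \<tau>_involutive [simp]: "\<tau> (\<tau> M) = M"
  using matrix_involution by (simp_all add: algebra_involution_def)

lemma \<tau>_entry: "\<tau> M $ i $ j = (\<Sum>m\<in>UNIV. \<Sum>n\<in>UNIV. M $ m $ n * mcoeff \<tau> m n i j)"
  by (subst matrix_eq_sum_units[of M]) (simp add: \<tau>_sum \<tau>_scale, simp add: mcoeff_def matrix_scale_def)

lemma \<tau>_one: "\<tau> (mat 1) = mat 1"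
  by (metis \<tau>_anti \<tau>_involutive matrix_mul_lid matrix_mul_rid)

lemma trace_\<tau>_commute: "(\<Sum>i\<in>UNIV. \<tau> (M ** N) $ i $ i) = (\<Sum>i\<in>UNIV. \<tau> (N ** M) $ i $ i)"
  unfolding \<tau>_anti by (simp add: matrix_matrix_mult_def mult.commute) (rule sum.swap)

text \<open>The functional \<open>M \<mapsto> tr (\<tau> M)\<close> vanishes on commutators, so it vanishes on \<open>E\<^bsub>mn\<^esub>\<close> for \<open>m \<noteq> n\<close> and
  has a constant value on the \<open>E\<^bsub>mm\<^esub>\<close>. This value is \<open>1\<close> because \<open>\<tau>\<close> fixes the unit matrix and the
  characteristic is zero.\<close>

lemma trace_\<tau>_unit: "(\<Sum>i\<in>UNIV. mcoeff \<tau> m n i i) = (if m = n then 1 else 0)"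
proof -
  let ?tr = "\<lambda>m n. \<Sum>i\<in>UNIV. \<tau> (matrix_unit m n) $ i $ i"
  have off: "?tr m n = 0" if "m \<noteq> n" for m n
    using trace_\<tau>_commute[of "matrix_unit m m" "matrix_unit m n"] that by (simp add: matrix_unit_mult)
  have diag: "?tr m m = ?tr n n" for m n
    using trace_\<tau>_commute[of "matrix_unit m n" "matrix_unit n m"] by (simp add: matrix_unit_mult)
  have one: "mat 1 = (\<Sum>m\<in>UNIV. matrix_unit m m :: 'k ^ 'n ^ 'n)"
  proof -
    have "(\<Sum>m\<in>UNIV. matrix_unit m m :: 'k ^ 'n ^ 'n) $ p $ q
        = (\<Sum>m\<in>UNIV. if m = p then if p = q then 1 else 0 else 0)" for p q
      unfolding sum_component by (rule sum.cong[OF refl]) (simp add: matrix_unit_def)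
    then show ?thesis by (simp add: vec_eq_iff sum.delta mat_def)
  qed
  have "of_nat CARD('n) * ?tr m m = (\<Sum>n\<in>UNIV. ?tr n n)"
    by (subst sum.cong[OF refl diag[of _ m]]) simp
  also have "\<dots> = (\<Sum>i\<in>UNIV. \<tau> (mat 1) $ i $ i)"
    unfolding one \<tau>_sum by (simp, rule sum.swap)
  also have "\<dots> = of_nat CARD('n)"
    by (simp add: \<tau>_one) (simp add: mat_def)
  finally have "?tr m m = 1" by simp
  with off show ?thesis by (cases "m = n") (simp_all add: mcoeff_def)
qed

lemma trace_\<tau>: "(\<Sum>i\<in>UNIV. \<tau> M $ i $ i) = (\<Sum>i\<in>UNIV. M $ i $ i)"
proof -
  have "(\<Sum>i\<in>UNIV. \<tau> M $ i $ i) = (\<Sum>i\<in>UNIV. \<Sum>m\<in>UNIV. \<Sum>n\<in>UNIV. M $ m $ n * mcoeff \<tau> m n i i)"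
    by (simp add: \<tau>_entry)
  also have "\<dots> = (\<Sum>m\<in>UNIV. \<Sum>n\<in>UNIV. \<Sum>i\<in>UNIV. M $ m $ n * mcoeff \<tau> m n i i)"
    by (subst sum.swap, rule sum.cong[OF refl], rule sum.swap)
  also have "\<dots> = (\<Sum>i\<in>UNIV. M $ i $ i)"
    by (simp add: trace_\<tau>_unit if_distrib sum.delta cong: if_cong flip: sum_distrib_left)
  finally show ?thesis .
qed

lemma mcoeff_involutive:
  "(\<Sum>m\<in>UNIV. \<Sum>n\<in>UNIV. mcoeff \<tau> p q m n * mcoeff \<tau> m n i j) = (if i = p \<and> j = q then 1 else 0)"
  using \<tau>_entry[of "\<tau> (matrix_unit p q)" i j] by (simp add: mcoeff_def matrix_unit_def)

text \<open>That is, \<open>\<tau>\<close> is selfadjoint for the trace form \<open>tr (M N)\<close>.\<close>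

lemma mcoeff_adjoint: "mcoeff \<tau> j k q m = mcoeff \<tau> m q k j"
proof -
  have tr: "(\<Sum>i\<in>UNIV. (matrix_unit a b ** N) $ i $ i) = N $ b $ a" for a b and N :: "'k ^ 'n ^ 'n"
    by (simp add: matrix_unit_mult_left sum.delta)
  have "mcoeff \<tau> j k q m = (\<Sum>i\<in>UNIV. \<tau> (matrix_unit m q ** \<tau> (matrix_unit j k)) $ i $ i)"
    by (simp add: trace_\<tau> tr mcoeff_def)
  also have "\<dots> = mcoeff \<tau> m q k j"
    by (simp add: \<tau>_anti tr mcoeff_def)
  finally show ?thesis .
qed

text \<open>The product of the entries \<open>ij\<close> of \<open>\<tau>(E\<^bsub>mn\<^esub>)\<close> and \<open>kl\<close> of \<open>\<tau>(E\<^bsub>pq\<^esub>)\<close> is the entry \<open>il\<close> of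
  \<open>\<tau>(E\<^bsub>mn\<^esub>) E\<^bsub>jk\<^esub> \<tau>(E\<^bsub>pq\<^esub>) = \<tau>(E\<^bsub>pq\<^esub> \<tau>(E\<^bsub>jk\<^esub>) E\<^bsub>mn\<^esub>)\<close>. The matrix inside \<open>\<tau>\<close> on the right is a multiple
  of \<open>E\<^bsub>pn\<^esub>\<close>. For the transposition the identity says that both sides are products of the same
  four Kronecker symbols.\<close>

lemma mcoeff_exchange: "mcoeff \<tau> m n i j * mcoeff \<tau> p q k l = mcoeff \<tau> m q k j * mcoeff \<tau> p n i l"
proof -
  have "mcoeff \<tau> m n i j * mcoeff \<tau> p q k l
      = (\<tau> (matrix_unit m n) ** (matrix_unit j k ** \<tau> (matrix_unit p q))) $ i $ l"
    by (simp add: matrix_matrix_mult_def[of "\<tau> (matrix_unit m n)"] matrix_unit_mult_left mcoeff_def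
        if_distrib[of "(*) _"] sum.delta cong: if_cong)
  also have "\<dots> = \<tau> ((matrix_unit p q ** \<tau> (matrix_unit j k)) ** matrix_unit m n) $ i $ l"
    by (simp add: \<tau>_anti)
  also have "(matrix_unit p q ** \<tau> (matrix_unit j k)) ** matrix_unit m n
      = matrix_scale (mcoeff \<tau> j k q m) (matrix_unit p n)"
    by (simp add: vec_eq_iff matrix_unit_mult_left matrix_unit_mult_right matrix_scale_def mcoeff_def)
      (simp add: matrix_unit_def)
  also have "\<tau> \<dots> $ i $ l = mcoeff \<tau> m q k j * mcoeff \<tau> p n i l"
    unfolding \<tau>_scale mcoeff_adjoint[of j k q m] by (simp add: matrix_scale_def mcoeff_def)
  finally show ?thesis .
qed

end

section \<open>The involution induced by \<open>\<phi>\<close> and \<open>\<tau>\<close>\<close>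

lemma sum_pairs:
  "(\<Sum>m\<in>UNIV. \<Sum>n\<in>UNIV. f m n) = (\<Sum>x\<in>(UNIV :: ('m::finite \<times> 'n::finite) set). f (fst x) (snd x))"
  by (simp add: sum.cartesian_product case_prod_unfold)

lemma sum_reverse3:
  "(\<Sum>a\<in>A. \<Sum>b\<in>B. \<Sum>c\<in>C. f a b c) = (\<Sum>c\<in>C. \<Sum>b\<in>B. \<Sum>a\<in>A. f a b c)"
proof -
  have "(\<Sum>a\<in>A. \<Sum>b\<in>B. \<Sum>c\<in>C. f a b c) = (\<Sum>a\<in>A. \<Sum>c\<in>C. \<Sum>b\<in>B. f a b c)"
    by (rule sum.cong[OF refl sum.swap])
  also have "\<dots> = (\<Sum>c\<in>C. \<Sum>a\<in>A. \<Sum>b\<in>B. f a b c)" by (rule sum.swap)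
  also have "\<dots> = (\<Sum>c\<in>C. \<Sum>b\<in>B. \<Sum>a\<in>A. f a b c)" by (rule sum.cong[OF refl sum.swap])
  finally show ?thesis .
qed

lemma coord_hom_linear_ext: "coord_hom f (linear_ext g x) = linear_ext (\<lambda>b. coord_hom f (g b)) x"
  by (simp add: linear_ext_def coord_hom_sum coord_hom_mult free_scale_coord)

lemma linear_ext_mult_both:
  fixes f g :: "'b \<Rightarrow> ('a, 'n, 'k::field) coord_poly"
  shows "linear_ext (\<lambda>b. (p * f b) * (q * g b)) x = (p * q) * linear_ext (\<lambda>b. f b * g b) x"
  by (subst linear_ext_mult_left[symmetric]) (simp only: mult.assoc mult.left_commute)

locale involutive_double_poisson_algebra =
  double_poisson_algebra scal db + matrix_involution \<tau>
  for scal :: "'k::field_char_0 \<Rightarrow> 'a::{ring, monoid_mult} \<Rightarrow> 'a"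
    and db :: "'a \<Rightarrow> 'a \<Rightarrow> ('a \<times> 'a \<Rightarrow>\<^sub>0 'k) set"
    and \<tau> :: "'k ^ 'n::finite ^ 'n \<Rightarrow> 'k ^ 'n ^ 'n" +
  fixes \<phi> :: "'a \<Rightarrow> 'a"
  assumes algebra_involution: "algebra_involution scal (*) \<phi>"
    and adapted: "adapted scal \<phi> db"
begin

lemma \<phi>_involutive [simp]: "\<phi> (\<phi> a) = a"
  using algebra_involution by (simp add: algebra_involution_def)

text \<open>Let \<open>X(a)\<close> be the matrix of the variables \<open>a\<^bsub>ij\<^esub>\<close>, and extend \<open>\<tau>\<close> linearly to matrices over \<open>P\<close>.
  Then \<open>\<theta>\<close> sends \<open>X(a)\<close> to \<open>\<tau>(X(\<phi> a))\<close>. The twisted relations say that \<open>\<theta>\<close> becomes the identity.\<close>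

definition \<theta> :: "('a, 'n, 'k) coord_poly \<Rightarrow> ('a, 'n, 'k) coord_poly" where
  "\<theta> = coord_hom (\<lambda>a i j. \<Sum>m\<in>UNIV. \<Sum>n\<in>UNIV. coord_const (mcoeff \<tau> m n i j) * coord_var (\<phi> a) m n)"

lemma \<theta>_add: "\<theta> (p + q) = \<theta> p + \<theta> q"
  and \<theta>_mult: "\<theta> (p * q) = \<theta> p * \<theta> q"
  and \<theta>_const [simp]: "\<theta> (coord_const c) = coord_const c"
  and \<theta>_zero [simp]: "\<theta> 0 = 0"
  and \<theta>_sum: "\<theta> (sum f S) = (\<Sum>s\<in>S. \<theta> (f s))"
  by (simp_all add: \<theta>_def coord_hom_add coord_hom_mult coord_hom_sum)

lemma \<theta>_var:
  "\<theta> (coord_var a i j) = (\<Sum>m\<in>UNIV. \<Sum>n\<in>UNIV. coord_const (mcoeff \<tau> m n i j) * coord_var (\<phi> a) m n)"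
  by (simp add: \<theta>_def)

lemma \<theta>_var_pairs:
  "\<theta> (coord_var a i j) =
     (\<Sum>x\<in>UNIV. coord_const (mcoeff \<tau> (fst x) (snd x) i j) * coord_var (\<phi> a) (fst x) (snd x))"
  by (simp add: \<theta>_var sum_pairs)

lemma \<theta>_involutive: "\<theta> (\<theta> p) = p"
proof (induction p rule: coord_poly_induct)
  case (var a i j)
  have "\<theta> (\<theta> (coord_var a i j)) =
      (\<Sum>x\<in>UNIV. \<Sum>y\<in>UNIV. coord_const (mcoeff \<tau> (fst x) (snd x) i j) *
        (coord_const (mcoeff \<tau> (fst y) (snd y) (fst x) (snd x)) * coord_var a (fst y) (snd y)))"
    unfolding \<theta>_var_pairs[of a] by (simp add: \<theta>_sum \<theta>_mult \<theta>_var_pairs sum_distrib_left)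
  also have "\<dots> = (\<Sum>y\<in>UNIV. coord_const
      (\<Sum>x\<in>UNIV. mcoeff \<tau> (fst y) (snd y) (fst x) (snd x) * mcoeff \<tau> (fst x) (snd x) i j)
        * coord_var a (fst y) (snd y))"
    by (subst sum.swap) (simp add: coord_const_sum coord_const_mult sum_distrib_left sum_distrib_right mult_ac)
  also have "\<dots> = (\<Sum>y\<in>UNIV. if y = (i, j) then coord_var a (fst y) (snd y) else 0)"
    by (rule sum.cong) (auto simp: mcoeff_involutive[unfolded sum_pairs])
  finally show ?case by (simp add: sum.delta)
qed (simp_all add: \<theta>_add \<theta>_mult)

lemma sweedler_adapted:
  "cong_mod I (linear_ext (\<lambda>(x', x''). coord_var (\<phi> x') i j * coord_var (\<phi> x'') k l) (db_rep a b))
     (sweedler_poly (db (\<phi> a) (\<phi> b)) k l i j)"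
proof -
  have "map2 scal \<phi> (db a b) = flip2 scal (db (\<phi> a) (\<phi> b))"
    using adapted unfolding adapted_def by blast
  then have "cong_mod I
      (ev2 i j k l (linear_ext (\<lambda>(x', x''). basis_vec (\<phi> x', \<phi> x'')) (db_rep a b)))
      (ev2 i j k l (linear_ext (\<lambda>(x', x''). basis_vec (x'', x')) (db_rep (\<phi> a) (\<phi> b))))"
    unfolding map2_def flip2_def quot_map_def by (rule ev2_cong)
  then show ?thesis
    by (simp add: ev2_def linear_ext_comp case_prod_unfold sweedler_poly_ev2 mult.commute)
qed

lemma vdb_scale_left: "vdb (coord_const c * p) q = coord_const c * vdb p q"
  by (simp add: vdb.mult_left)

lemma vdb_scale_right: "vdb p (coord_const c * q) = coord_const c * vdb p q"
  by (simp add: vdb.mult_right)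

text \<open>Both sides are combinations of the evaluations of \<open>\<lbrace>\<phi> a, \<phi> b\<rbrace>\<close>, the right side by adaptedness. The
  coefficients are the two sides of \<open>mcoeff_exchange\<close>.\<close>

lemma \<theta>_poisson_var:
  "cong_mod I (vdb (\<theta> (coord_var a i j)) (\<theta> (coord_var b k l))) (\<theta> (vdb (coord_var a i j) (coord_var b k l)))"
proof -
  let ?S = "sweedler_poly (db (\<phi> a) (\<phi> b)) :: 'n \<Rightarrow> 'n \<Rightarrow> 'n \<Rightarrow> 'n \<Rightarrow> ('a, 'n, 'k) coord_poly"
  let ?c = "\<lambda>m q p n. coord_const (mcoeff \<tau> m q k j * mcoeff \<tau> p n i l) :: ('a, 'n, 'k) coord_poly"
  let ?T = "\<lambda>m q p n. linear_ext (\<lambda>(x', x''). coord_var (\<phi> x') m q * coord_var (\<phi> x'') p n) (db_rep a b)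
    :: ('a, 'n, 'k) coord_poly"
  have "vdb (\<theta> (coord_var a i j)) (\<theta> (coord_var b k l)) = (\<Sum>m\<in>UNIV. \<Sum>n\<in>UNIV. \<Sum>p\<in>UNIV. \<Sum>q\<in>UNIV.
      coord_const (mcoeff \<tau> m n i j * mcoeff \<tau> p q k l) * ?S p n m q)"
    unfolding \<theta>_var vdb.sum_left vdb_scale_left
    by (simp add: vdb.sum_right vdb_scale_right coord_const_mult sum_distrib_left mult.assoc)
  also have "\<dots> = (\<Sum>m\<in>UNIV. \<Sum>q\<in>UNIV. \<Sum>p\<in>UNIV. \<Sum>n\<in>UNIV. ?c m q p n * ?S p n m q)"
    unfolding mcoeff_exchange[of _ _ i j _ _ k l] by (rule sum.cong[OF refl sum_reverse3])
  finally have lhs: "vdb (\<theta> (coord_var a i j)) (\<theta> (coord_var b k l)) = \<dots>" .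
  have rhs: "\<theta> (vdb (coord_var a i j) (coord_var b k l)) =
      (\<Sum>m\<in>UNIV. \<Sum>q\<in>UNIV. \<Sum>p\<in>UNIV. \<Sum>n\<in>UNIV. ?c m q p n * ?T m q p n)"
    unfolding vdb_var sweedler_poly_ev2 ev2_def \<theta>_def coord_hom_linear_ext
    by (simp only: case_prod_unfold coord_hom_mult coord_hom_var sum_distrib_right,
        simp only: sum_distrib_left linear_ext_sum_fun,
        simp only: coord_const_mult linear_ext_mult_both)
  show ?thesis
    unfolding lhs rhs by (intro I_sum, rule I_mult[OF I_refl I_sym[OF sweedler_adapted]])
qed

lemma \<theta>_poisson: "cong_mod I (vdb (\<theta> p) (\<theta> q)) (\<theta> (vdb p q))"
proof (induction p rule: coord_poly_induct)
  case (var a i j)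
  show ?case
  proof (induction q rule: coord_poly_induct)
    case (var b k l)
    show ?case by (rule \<theta>_poisson_var)
  qed (auto simp: \<theta>_add \<theta>_mult vdb.add_right vdb.mult_right I_refl intro!: I_add I_mult)
qed (auto simp: \<theta>_add \<theta>_mult vdb.add_left vdb.mult_left I_refl intro!: I_add I_mult)

sublocale poisson_reduction "I :: ('a, 'n, 'k) coord_poly set" vdb \<theta>
  by (intro poisson_reduction.intro poisson_mod_vdb vdb.biderivation_axioms poisson_reduction_axioms.intro
      \<theta>_add \<theta>_mult \<theta>_involutive \<theta>_poisson)

end

section \<open>The twisted coordinate ring as a quotient of the polynomial ring\<close>

lemma minus_ring_of_type_algebra [simp]:
  fixes x y :: "'r::comm_ring_1"
  shows "x \<ominus>\<^bsub>ring_of_type_algebra\<^esub> y = x - y"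
proof -
  interpret ring "ring_of_type_algebra :: 'r ring"
    by (rule ring_from_type_algebra)
  have "\<ominus>\<^bsub>ring_of_type_algebra\<^esub> y = - y"
    by (rule minus_equality) auto
  then show ?thesis by (simp add: a_minus_def)
qed

lemma ideal_coord_ideal: "ideal (coord_ideal scal) ring_of_type_algebra"
  by (simp add: ideal_ring_of_type_algebra_iff is_ideal_coord_ideal)

lemma coord_class_hom:
  fixes scal :: "'k::field \<Rightarrow> 'a::{ring, monoid_mult} \<Rightarrow> 'a"
  shows "ring_hom_ring ring_of_type_algebra (coord_ring scal)
    (coord_class scal :: ('a, 'n::finite, 'k) coord_poly \<Rightarrow> _)"
proof -
  have "(coord_class scal :: ('a, 'n, 'k) coord_poly \<Rightarrow> _)
      = (+>\<^bsub>ring_of_type_algebra\<^esub>) (coord_ideal scal)"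
    by (simp add: fun_eq_iff coord_class_def)
  then show ?thesis
    unfolding coord_ring_def by (simp only: ideal.rcos_ring_hom_ring[OF ideal_coord_ideal])
qed

lemma carrier_coord_ring: "carrier (coord_ring scal) = range (coord_class scal)"
  by (auto simp: coord_ring_def FactRing_def A_RCOSETS_def' coord_class_def)

lemma coord_class_eq_iff: "coord_class scal p = coord_class scal q \<longleftrightarrow> cong_mod (coord_ideal scal) p q"
  using ring.quotient_eq_iff_same_a_r_cos[OF ring_from_type_algebra ideal_coord_ideal, of p q scal]
  by (simp add: cong_mod_def coord_class_def)

definition twisted_relations ::
    "('a \<Rightarrow> 'a) \<Rightarrow> ('k::field ^ 'n::finite ^ 'n \<Rightarrow> 'k ^ 'n ^ 'n) \<Rightarrow> ('a, 'n, 'k) coord_poly set" where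
  "twisted_relations \<phi> \<tau> = {coord_var (\<phi> a) i j -
     (\<Sum>m\<in>UNIV. \<Sum>n\<in>UNIV. coord_const (mcoeff \<tau> m n i j) * coord_var a m n) | a i j. True}"

lemma twisted_ideal_conv: "twisted_ideal scal \<phi> \<tau> = genideal (coord_ring scal) (coord_class scal ` twisted_relations \<phi> \<tau>)"
  unfolding twisted_ideal_def twisted_relations_def
  by (rule arg_cong[where f = "genideal _"]) blast

context
  fixes scal :: "'k::field \<Rightarrow> 'a::{ring, monoid_mult} \<Rightarrow> 'a" and \<phi> :: "'a \<Rightarrow> 'a"
    and \<tau> :: "'k ^ 'n::finite ^ 'n \<Rightarrow> 'k ^ 'n ^ 'n"
begin

interpretation cc: ring_hom_ring ring_of_type_algebra "coord_ring scal"
  "coord_class scal :: ('a, 'n, 'k) coord_poly \<Rightarrow> _"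
  by (rule coord_class_hom)

lemma ideal_twisted_ideal: "ideal (twisted_ideal scal \<phi> \<tau>) (coord_ring scal)"
  unfolding twisted_ideal_conv by (rule cc.S.genideal_ideal) (auto simp: carrier_coord_ring)

text \<open>The twisted ring is a quotient of the quotient \<open>coord_ring\<close>. Its kernel in \<open>P\<close> is the preimage of
  \<open>twisted_ideal\<close>, which is generated by both families of relations.\<close>

lemma coord_class_mem_twisted_ideal:
  "coord_class scal p \<in> twisted_ideal scal \<phi> \<tau> \<longleftrightarrow>
     p \<in> ideal_hull (coord_ideal scal \<union> twisted_relations \<phi> \<tau>)"
proof
  let ?H = "ideal_hull (coord_ideal scal \<union> twisted_relations \<phi> \<tau>)"
  interpret T: ideal "twisted_ideal scal \<phi> \<tau>" "coord_ring scal"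
    by (rule ideal_twisted_ideal)
  assume "p \<in> ?H"
  moreover have "?H \<subseteq> {p. coord_class scal p \<in> twisted_ideal scal \<phi> \<tau>}"
  proof (rule regular.span_minimal)
    have "coord_class scal p \<in> twisted_ideal scal \<phi> \<tau>" if "p \<in> coord_ideal scal" for p
    proof -
      have "coord_class scal p = coord_class scal 0"
        using that by (simp add: coord_class_eq_iff cong_mod_def)
      also have "\<dots> = \<zero>\<^bsub>coord_ring scal\<^esub>"
        using cc.hom_zero by simp
      finally show ?thesis by simp
    qed
    moreover have "coord_class scal p \<in> twisted_ideal scal \<phi> \<tau>" if "p \<in> twisted_relations \<phi> \<tau>" for p
      unfolding twisted_ideal_conv using that
      by (intro subsetD[OF cc.S.genideal_self]) (auto simp: carrier_coord_ring)
    ultimately show "coord_ideal scal \<union> twisted_relations \<phi> \<tau>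
        \<subseteq> {p. coord_class scal p \<in> twisted_ideal scal \<phi> \<tau>}" by blast
    show "is_ideal {p. coord_class scal p \<in> twisted_ideal scal \<phi> \<tau>}"
    proof (rule regular.subspaceI)
      show "0 \<in> {p. coord_class scal p \<in> twisted_ideal scal \<phi> \<tau>}"
        using cc.hom_zero by simp
    next
      fix p q
      assume "p \<in> {p. coord_class scal p \<in> twisted_ideal scal \<phi> \<tau>}"
        "q \<in> {p. coord_class scal p \<in> twisted_ideal scal \<phi> \<tau>}"
      then show "p + q \<in> {p. coord_class scal p \<in> twisted_ideal scal \<phi> \<tau>}"
        using cc.hom_add[of p q] by simp
    next
      fix c p
      assume "p \<in> {p. coord_class scal p \<in> twisted_ideal scal \<phi> \<tau>}"
      then show "c * p \<in> {p. coord_class scal p \<in> twisted_ideal scal \<phi> \<tau>}"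
        using cc.hom_mult[of c p] T.I_l_closed[of "coord_class scal p" "coord_class scal c"]
        by (simp add: carrier_coord_ring)
    qed
  qed
  ultimately show "coord_class scal p \<in> twisted_ideal scal \<phi> \<tau>" by blast
next
  let ?H = "ideal_hull (coord_ideal scal \<union> twisted_relations \<phi> \<tau>)"
  have H: "ideal ?H ring_of_type_algebra"
    by (simp add: ideal_ring_of_type_algebra_iff)
  have "ideal (coord_class scal ` ?H) (coord_ring scal)"
  proof (rule idealI[OF cc.S.ring_axioms])
    show "subgroup (coord_class scal ` ?H) (add_monoid (coord_ring scal))"
      using additive_subgroup.a_subgroup[OF ideal.axioms(1)[OF H]] by (rule cc.img_is_add_subgroup)
  next
    fix x y :: "('a, 'n, 'k) coord_poly set"
    assume "x \<in> coord_class scal ` ?H" "y \<in> carrier (coord_ring scal)"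
    then obtain p q where p: "p \<in> ?H" "x = coord_class scal p" and q: "y = coord_class scal q"
      by (auto simp: carrier_coord_ring)
    have "q * p \<in> ?H" by (rule regular.span_scale[OF p(1)])
    then have mem: "coord_class scal (q * p) \<in> coord_class scal ` ?H" by blast
    show "y \<otimes>\<^bsub>coord_ring scal\<^esub> x \<in> coord_class scal ` ?H"
      using mem cc.hom_mult[of q p] by (simp add: p q)
    show "x \<otimes>\<^bsub>coord_ring scal\<^esub> y \<in> coord_class scal ` ?H"
      using mem cc.hom_mult[of p q] by (simp add: p q mult.commute)
  qed
  moreover have "coord_class scal ` twisted_relations \<phi> \<tau> \<subseteq> coord_class scal ` ?H"
    using regular.span_superset by blast
  ultimately have "twisted_ideal scal \<phi> \<tau> \<subseteq> coord_class scal ` ?H"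
    unfolding twisted_ideal_conv by (rule cc.S.genideal_minimal)
  moreover assume "coord_class scal p \<in> twisted_ideal scal \<phi> \<tau>"
  ultimately obtain k where k: "k \<in> ?H" "coord_class scal p = coord_class scal k" by blast
  then have "p - k \<in> coord_ideal scal"
    by (simp add: coord_class_eq_iff cong_mod_def)
  then have "p - k \<in> ?H"
    by (intro regular.span_base) blast
  then show "p \<in> ?H"
    using regular.span_add[OF _ k(1), of "p - k"] by simp
qed

interpretation tc: ring_hom_ring "coord_ring scal" "twisted_ring scal \<phi> \<tau>"
  "(+>\<^bsub>coord_ring scal\<^esub>) (twisted_ideal scal \<phi> \<tau>)"
  unfolding twisted_ring_def by (rule ideal.rcos_ring_hom_ring[OF ideal_twisted_ideal])

lemma carrier_twisted_ring: "carrier (twisted_ring scal \<phi> \<tau>) = range (twisted_class scal \<phi> \<tau>)"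
proof -
  have "carrier (twisted_ring scal \<phi> \<tau>)
      = (\<lambda>x. twisted_ideal scal \<phi> \<tau> +>\<^bsub>coord_ring scal\<^esub> x) ` carrier (coord_ring scal)"
    unfolding twisted_ring_def FactRing_def A_RCOSETS_def' by (simp add: UNION_singleton_eq_range)
  then show ?thesis
    by (simp only: carrier_coord_ring image_image twisted_class_def[abs_def])
qed

lemma twisted_class_add:
  "twisted_class scal \<phi> \<tau> (p + q) =
     twisted_class scal \<phi> \<tau> p \<oplus>\<^bsub>twisted_ring scal \<phi> \<tau>\<^esub> twisted_class scal \<phi> \<tau> q"
  using cc.hom_add[of p q] tc.hom_add[of "coord_class scal p" "coord_class scal q"]
  by (simp add: twisted_class_def carrier_coord_ring)

lemma twisted_class_mult:
  "twisted_class scal \<phi> \<tau> (p * q) =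
     twisted_class scal \<phi> \<tau> p \<otimes>\<^bsub>twisted_ring scal \<phi> \<tau>\<^esub> twisted_class scal \<phi> \<tau> q"
  using cc.hom_mult[of p q] tc.hom_mult[of "coord_class scal p" "coord_class scal q"]
  by (simp add: twisted_class_def carrier_coord_ring)

lemma twisted_class_zero: "twisted_class scal \<phi> \<tau> 0 = \<zero>\<^bsub>twisted_ring scal \<phi> \<tau>\<^esub>"
  using cc.hom_zero tc.hom_zero by (simp add: twisted_class_def)

lemma twisted_class_eq_iff:
  "twisted_class scal \<phi> \<tau> p = twisted_class scal \<phi> \<tau> q \<longleftrightarrow>
     cong_mod (ideal_hull (coord_ideal scal \<union> twisted_relations \<phi> \<tau>)) p q"
proof -
  have "coord_class scal p = coord_class scal (p - q) \<oplus>\<^bsub>coord_ring scal\<^esub> coord_class scal q"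
    using cc.hom_add[of "p - q" q] by simp
  then have "coord_class scal p \<ominus>\<^bsub>coord_ring scal\<^esub> coord_class scal q = coord_class scal (p - q)"
    using cc.hom_closed by (simp add: cc.S.minus_eq cc.S.a_assoc cc.S.r_neg)
  then show ?thesis
    using cc.S.quotient_eq_iff_same_a_r_cos[OF ideal_twisted_ideal, of "coord_class scal p" "coord_class scal q"]
    by (simp add: carrier_coord_ring twisted_class_def coord_class_mem_twisted_ideal cong_mod_def)
qed

end

section \<open>Poisson brackets on quotients of the polynomial ring\<close>

text \<open>A ring given as the image of \<open>P\<close> under a homomorphism with kernel \<open>J\<close>. Only the structure that
  enters in \<open>poisson_bracket\<close> is recorded.\<close>

locale coord_quotient =
  fixes R :: "('c, 'm) ring_scheme" (structure)
    and scl :: "'k::field_char_0 \<Rightarrow> 'c \<Rightarrow> 'c"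
    and \<pi> :: "('a, 'n, 'k) coord_poly \<Rightarrow> 'c"
    and J :: "('a, 'n, 'k) coord_poly set"
  assumes carrier: "carrier R = range \<pi>"
    and eq_iff: "\<pi> p = \<pi> q \<longleftrightarrow> cong_mod J p q"
    and add: "\<pi> (p + q) = \<pi> p \<oplus> \<pi> q"
    and mult: "\<pi> (p * q) = \<pi> p \<otimes> \<pi> q"
    and zero: "\<pi> 0 = \<zero>"
    and scl: "scl c (\<pi> p) = \<pi> (coord_const c * p)"
begin

lemma poisson_bracket_of_lift:
  assumes C: "poisson_mod J C" and const: "\<And>p c. C p (coord_const c) \<in> J"
  shows "\<exists>B. B \<in> carrier R \<rightarrow>\<^sub>E (carrier R \<rightarrow>\<^sub>E carrier R) \<and> poisson_bracket R scl B
    \<and> (\<forall>p q. B (\<pi> p) (\<pi> q) = \<pi> (C p q))"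
proof -
  interpret C: poisson_mod J C by (rule C)
  define B where "B = (\<lambda>x\<in>carrier R. \<lambda>y\<in>carrier R. \<pi> (C (inv_into UNIV \<pi> x) (inv_into UNIV \<pi> y)))"
  have inv: "cong_mod J (inv_into UNIV \<pi> (\<pi> p)) p" for p
    using f_inv_into_f[of "\<pi> p" \<pi> UNIV] by (simp flip: eq_iff)
  have B: "B (\<pi> p) (\<pi> q) = \<pi> (C p q)" for p q
  proof -
    have "cong_mod J (C (inv_into UNIV \<pi> (\<pi> p)) (inv_into UNIV \<pi> (\<pi> q))) (C p q)"
      using C.cong_left[OF inv] C.cong_right[OF inv] C.cm_trans by blast
    then show ?thesis
      by (simp add: B_def carrier eq_iff rangeI)
  qed
  have scale_right: "cong_mod J (C p (coord_const c * q)) (coord_const c * C p q)" for c p q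
  proof -
    have "cong_mod J (C p (coord_const c * q)) (C p (coord_const c) * q + coord_const c * C p q)"
      by (rule C.times_right)
    also have "cong_mod J \<dots> (0 * q + coord_const c * C p q)"
      using const by (intro C.cm_add C.cm_mult C.cm_refl) (simp add: cong_mod_0_iff[OF C.ideal])
    finally show ?thesis by simp
  qed
  have scale_left: "cong_mod J (C (coord_const c * p) q) (coord_const c * C p q)" for c p q
  proof -
    have "cong_mod J (C (coord_const c * p) q) (- C q (coord_const c * p))" by (rule C.antisym)
    also have "cong_mod J \<dots> (- (coord_const c * C q p))" by (rule C.cm_uminus[OF scale_right])
    also have "- (coord_const c * C q p) = coord_const c * - C q p" by simp
    also have "cong_mod J \<dots> (coord_const c * C p q)" by (intro C.cm_mult C.cm_refl C.cm_sym[OF C.antisym])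
    finally show ?thesis .
  qed
  (* Antisymmetry only gives that twice \<open>C p p\<close> lies in \<open>J\<close>; characteristic zero is used here. *)
  have self: "C p p \<in> J" for p
  proof -
    have "coord_const (1 / 2) * (C p p - - C p p) = (coord_const (1 / 2) + coord_const (1 / 2)) * C p p"
      by (simp add: algebra_simps)
    also have "\<dots> = C p p"
      by (simp flip: coord_const_add)
    finally show ?thesis
      using regular.subspace_scale[OF C.ideal C.antisym[of p p, unfolded cong_mod_def], of "coord_const (1 / 2)"]
      by simp
  qed
  have "poisson_bracket R scl B"
    unfolding poisson_bracket_def carrier
  proof (intro conjI ballI allI; (elim rangeE)?)
    show "B \<in> range \<pi> \<rightarrow> range \<pi> \<rightarrow> range \<pi>" by (auto simp: B)
  qed (simp_all add: B scl C.plus_left C.plus_right scale_left scale_right C.times_left C.times_right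
      C.jacobi[unfolded cong_mod_0_iff[OF C.ideal]] self cong_mod_0_iff[OF C.ideal] eq_iff flip: add mult zero)
  moreover have "B \<in> carrier R \<rightarrow>\<^sub>E (carrier R \<rightarrow>\<^sub>E carrier R)"
    by (auto simp: B_def carrier)
  ultimately show ?thesis using B by blast
qed

text \<open>A Poisson bracket vanishes if one argument is a scalar, since \<open>B x 1 = B x 1 + B x 1\<close>. The Leibniz rule
  thus determines it by its values on pairs of generators.\<close>

lemma poisson_bracket_eqI:
  assumes J: "is_ideal J"
    and B: "poisson_bracket R scl B" "B \<in> carrier R \<rightarrow>\<^sub>E (carrier R \<rightarrow>\<^sub>E carrier R)"
    and B': "poisson_bracket R scl B'" "B' \<in> carrier R \<rightarrow>\<^sub>E (carrier R \<rightarrow>\<^sub>E carrier R)"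
    and vars: "\<And>a b i j k l. B (\<pi> (coord_var a i j)) (\<pi> (coord_var b k l)) = B' (\<pi> (coord_var a i j)) (\<pi> (coord_var b k l))"
  shows "B = B'"
proof -
  have const: "D (\<pi> (coord_const c)) (\<pi> p) = \<zero>" "D (\<pi> p) (\<pi> (coord_const c)) = \<zero>"
    if D: "poisson_bracket R scl D" for D c p
  proof -
    have range: "\<exists>u. D (\<pi> p) (\<pi> q) = \<pi> u" for p q
    proof -
      have "D (\<pi> p) (\<pi> q) \<in> range \<pi>"
        using D by (simp add: poisson_bracket_def carrier Pi_iff)
      then show ?thesis by blast
    qed
    have idem: "u \<in> J" if "\<pi> u = \<pi> (u * 1 + 1 * u)" for u
      using that regular.subspace_neg[OF J, of "- u"] by (simp add: eq_iff cong_mod_def)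
    obtain u where u: "D (\<pi> 1) (\<pi> p) = \<pi> u" using range by blast
    have "D (\<pi> 1 \<otimes> \<pi> 1) (\<pi> p) = D (\<pi> 1) (\<pi> p) \<otimes> \<pi> 1 \<oplus> \<pi> 1 \<otimes> D (\<pi> 1) (\<pi> p)"
      using D unfolding poisson_bracket_def carrier by blast
    then have "\<pi> u = \<pi> (u * 1 + 1 * u)"
      by (simp add: u flip: mult add)
    then have "coord_const c * u \<in> J" for c by (intro regular.subspace_scale J idem)
    moreover have "D (scl c (\<pi> 1)) (\<pi> p) = scl c (D (\<pi> 1) (\<pi> p))"
      using D unfolding poisson_bracket_def carrier by blast
    ultimately show "D (\<pi> (coord_const c)) (\<pi> p) = \<zero>"
      by (simp add: scl u eq_iff cong_mod_0_iff[OF J] flip: zero)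
    obtain v where v: "D (\<pi> p) (\<pi> 1) = \<pi> v" using range by blast
    have "D (\<pi> p) (\<pi> 1 \<otimes> \<pi> 1) = D (\<pi> p) (\<pi> 1) \<otimes> \<pi> 1 \<oplus> \<pi> 1 \<otimes> D (\<pi> p) (\<pi> 1)"
      using D unfolding poisson_bracket_def carrier by blast
    then have "\<pi> v = \<pi> (v * 1 + 1 * v)"
      by (simp add: v flip: mult add)
    then have "coord_const c * v \<in> J" for c by (intro regular.subspace_scale J idem)
    moreover have "D (\<pi> p) (scl c (\<pi> 1)) = scl c (D (\<pi> p) (\<pi> 1))"
      using D unfolding poisson_bracket_def carrier by blast
    ultimately show "D (\<pi> p) (\<pi> (coord_const c)) = \<zero>"
      by (simp add: scl v eq_iff cong_mod_0_iff[OF J] flip: zero)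
  qed
  have add_mult: "D (\<pi> (p + q)) (\<pi> r) = D (\<pi> p) (\<pi> r) \<oplus> D (\<pi> q) (\<pi> r)"
    "D (\<pi> r) (\<pi> (p + q)) = D (\<pi> r) (\<pi> p) \<oplus> D (\<pi> r) (\<pi> q)"
    "D (\<pi> (p * q)) (\<pi> r) = D (\<pi> p) (\<pi> r) \<otimes> \<pi> q \<oplus> \<pi> p \<otimes> D (\<pi> q) (\<pi> r)"
    "D (\<pi> r) (\<pi> (p * q)) = D (\<pi> r) (\<pi> p) \<otimes> \<pi> q \<oplus> \<pi> p \<otimes> D (\<pi> r) (\<pi> q)"
    if "poisson_bracket R scl D" for D p q r
    using that unfolding poisson_bracket_def carrier add mult by blast+
  have "B (\<pi> p) (\<pi> q) = B' (\<pi> p) (\<pi> q)" for p q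
  proof (induction p rule: coord_poly_induct)
    case (var a i j)
    show ?case
      by (induction q rule: coord_poly_induct)
        (simp_all add: vars const B(1) B'(1) add_mult)
  qed (simp_all add: const B(1) B'(1) add_mult)
  then have "B x y = B' x y" if "x \<in> carrier R" "y \<in> carrier R" for x y
    using that by (auto simp: carrier)
  then show ?thesis
    using B(2) B'(2) by (intro PiE_ext[OF B(2) B'(2)] PiE_ext[where k = "carrier R"]) auto
qed

end

section \<open>The Poisson bracket of the twisted coordinate ring\<close>

context involutive_double_poisson_algebra
begin

text \<open>A twisted relation for \<open>a\<close> is \<open>p - \<theta> p\<close> for the variable \<open>p = \<phi>(a)\<^bsub>ij\<^esub>\<close>, and every variable has this
  form because \<open>\<phi>\<close> is an involution. Modulo the relations \<open>\<theta>\<close> is thus the identity on the variables,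
  and hence on \<open>P\<close>.\<close>

lemma coinv_ideal_eq: "ideal_hull (I \<union> twisted_relations \<phi> \<tau>) = coinv_ideal"
proof -
  let ?H = "ideal_hull (I \<union> twisted_relations \<phi> \<tau>)"
  have rel: "coord_var (\<phi> a) i j - \<theta> (coord_var (\<phi> a) i j) \<in> twisted_relations \<phi> \<tau>" for a i j
    unfolding \<theta>_var twisted_relations_def by auto
  have "twisted_relations \<phi> \<tau> \<subseteq> coinv_ideal"
  proof
    fix p assume "p \<in> twisted_relations \<phi> \<tau>"
    then obtain a i j where "p = coord_var (\<phi> a) i j - \<theta> (coord_var (\<phi> a) i j)"
      by (auto simp: twisted_relations_def \<theta>_var)
    then show "p \<in> coinv_ideal"
      using J_sym[OF \<theta>_cong] by (simp add: cong_mod_def)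
  qed
  then have "?H \<subseteq> coinv_ideal"
    using ideal_le_coinv by (intro regular.span_minimal coinv_ideal) auto
  moreover have "\<theta> p - p \<in> ?H" for p
  proof (induction p rule: coord_poly_induct)
    case (const c)
    show ?case by (simp add: regular.span_zero)
  next
    case (var a i j)
    show ?case
      using regular.span_neg[OF regular.span_base[OF UnI2[OF rel[of "\<phi> a" i j], of I]]] by simp
  next
    case (add p q)
    then show ?case
      using regular.span_add[of "\<theta> p - p" _ "\<theta> q - q"] by (simp add: \<theta>_add algebra_simps)
  next
    case (mult p q)
    have "\<theta> (p * q) - p * q = \<theta> p * (\<theta> q - q) + q * (\<theta> p - p)"
      by (simp add: \<theta>_mult algebra_simps)
    then show ?case
      using mult by (simp add: regular.span_add regular.span_scale)
  qed
  then have "coinv_ideal \<subseteq> ?H"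
    unfolding coinv_ideal_def by (intro regular.span_minimal) (auto intro: regular.span_base)
  ultimately show ?thesis by blast
qed

lemma reduced_var:
  "reduced (coord_var a i j) (coord_var b k l) = sweedler_poly (db a b) k j i l +
     (\<Sum>m\<in>UNIV. \<Sum>n\<in>UNIV. coord_const (mcoeff \<tau> m n i j) * sweedler_poly (db (\<phi> a) b) k n m l)"
  by (simp add: reduced_def vdb.add_left \<theta>_var vdb.sum_left vdb_scale_left)

lemma reduced_const: "reduced p (coord_const c) = 0"
  by (simp add: reduced_def)

sublocale quotient: coord_quotient "twisted_ring scal \<phi> \<tau>" "twisted_smult scal \<phi> \<tau>"
  "twisted_class scal \<phi> \<tau>" coinv_ideal
  by unfold_locales (simp_all add: carrier_twisted_ring twisted_class_eq_iff coinv_ideal_eq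
      twisted_class_add twisted_class_mult twisted_class_zero twisted_smult_def)

end

theorem theorem1p8:
  fixes scal :: "'k::{alg_closed_field, field_char_0} \<Rightarrow> 'a::{ring, monoid_mult} \<Rightarrow> 'a"
    and \<phi> :: "'a \<Rightarrow> 'a"
    and \<tau> :: "'k ^ 'n::finite ^ 'n \<Rightarrow> 'k ^ 'n ^ 'n"
    and db :: "'a \<Rightarrow> 'a \<Rightarrow> ('a \<times> 'a \<Rightarrow>\<^sub>0 'k) set"
  assumes "k_algebra scal"
    and "finitely_generated_algebra scal"
    and "algebra_involution scal (*) \<phi>"
    and "double_poisson_bracket scal db"
    and "adapted scal \<phi> db"
    and "algebra_involution matrix_scale (**) \<tau>"
  shows "\<exists>!B. B \<in> carrier (twisted_ring scal \<phi> \<tau>) \<rightarrow>\<^sub>E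
                (carrier (twisted_ring scal \<phi> \<tau>) \<rightarrow>\<^sub>E carrier (twisted_ring scal \<phi> \<tau>)) \<and>
            poisson_bracket (twisted_ring scal \<phi> \<tau>) (twisted_smult scal \<phi> \<tau>) B \<and>
            (\<forall>a b i j k l.
               B (twisted_gen scal \<phi> \<tau> a i j) (twisted_gen scal \<phi> \<tau> b k l) =
               twisted_class scal \<phi> \<tau>
                 (sweedler_poly (db a b) k j i l +
                  (\<Sum>m\<in>UNIV. \<Sum>n\<in>UNIV.
                     coord_const (mcoeff \<tau> m n i j) * sweedler_poly (db (\<phi> a) b) k n m l)))"
proof -
  interpret involutive_double_poisson_algebra scal db \<tau> \<phi>
    using assms by (intro involutive_double_poisson_algebra.intro double_poisson_algebra.intro
        double_poisson_algebra_axioms.intro matrix_involution.intro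
        involutive_double_poisson_algebra_axioms.intro)
  obtain B where B: "B \<in> carrier (twisted_ring scal \<phi> \<tau>) \<rightarrow>\<^sub>E
        (carrier (twisted_ring scal \<phi> \<tau>) \<rightarrow>\<^sub>E carrier (twisted_ring scal \<phi> \<tau>))"
      "poisson_bracket (twisted_ring scal \<phi> \<tau>) (twisted_smult scal \<phi> \<tau>) B"
    and "\<forall>p q. B (twisted_class scal \<phi> \<tau> p) (twisted_class scal \<phi> \<tau> q)
        = twisted_class scal \<phi> \<tau> (reduced p q)"
    using quotient.poisson_bracket_of_lift[OF reduced_poisson_mod]
    by (auto simp: reduced_const regular.subspace_0[OF coinv_ideal])
  then have B_gen: "B (twisted_gen scal \<phi> \<tau> a i j) (twisted_gen scal \<phi> \<tau> b k l) =
      twisted_class scal \<phi> \<tau>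
        (sweedler_poly (db a b) k j i l +
          (\<Sum>m\<in>UNIV. \<Sum>n\<in>UNIV.
             coord_const (mcoeff \<tau> m n i j) * sweedler_poly (db (\<phi> a) b) k n m l))" for a b i j k l
    by (simp add: twisted_gen_def reduced_var)
  show ?thesis
  proof (rule ex1I[of _ B], intro conjI allI B B_gen, elim conjE)
    fix B' assume B': "B' \<in> carrier (twisted_ring scal \<phi> \<tau>) \<rightarrow>\<^sub>E
        (carrier (twisted_ring scal \<phi> \<tau>) \<rightarrow>\<^sub>E carrier (twisted_ring scal \<phi> \<tau>))"
      "poisson_bracket (twisted_ring scal \<phi> \<tau>) (twisted_smult scal \<phi> \<tau>) B'"
      and B'_gen: "\<forall>a b i j k l.
               B' (twisted_gen scal \<phi> \<tau> a i j) (twisted_gen scal \<phi> \<tau> b k l) =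
               twisted_class scal \<phi> \<tau>
                 (sweedler_poly (db a b) k j i l +
                  (\<Sum>m\<in>UNIV. \<Sum>n\<in>UNIV.
                     coord_const (mcoeff \<tau> m n i j) * sweedler_poly (db (\<phi> a) b) k n m l))"
    show "B' = B"
      by (rule quotient.poisson_bracket_eqI[OF coinv_ideal B'(2,1) B(2,1)])
        (simp add: B_gen B'_gen flip: twisted_gen_def)
  qed
qed

end
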